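(* Let $(M,g)$ be a compact and connected Riemannian manifold, let $\phi:M\to\mathbb{C}$ be a non-constant smooth map, and let $\lambda<0$ be a real number. The following are equivalent: (i) $\phi$ is a $(\lambda,\lambda)$-eigenfunction on $(M,g)$. (ii) For any $x_0\in M$ the map $$\pi:(M,g)\to \left(S^1,\tfrac{1}{|\lambda|}\,dt^2\right),\qquad x\mapsto \frac{\phi(x)}{|\phi(x_0)|}$$ is a well-defined harmonic Riemannian submersion (well-defined includes that $\phi(x_0)\neq 0$ and that the map takes values in the unit circle $S^1\subset\mathbb{C}$).
   Context: For a Riemannian manifold $(M,g)$, extend $g$ complex bilinearly to the complexified tangent bundle, so that the gradient $\nabla\phi$ of a smooth function $\phi:M\to\mathbb{C}$ is a section of $T^{\mathbb{C}}M$. Let $\tau(\phi)=\operatorname{div}(\nabla\phi)$ be the (complex linear) Laplace-Beltrami operator and $\kappa(\phi,\psi)=g(\nabla\phi,\nabla\psi)$ (complex bilinear, no conjugation). For $\lambda,\mu\in\mathbb{C}$, a smooth function $\phi:M\to\mathbb{C}$ is a $(\lambda,\mu)$-eigenfunction if $\tau(\phi)=\lambda\phi$ and $\kappa(\phi,\phi)=\mu\phi^2$. Compact manifolds are without boundary. $S^1\subset\mathbb{C}$ is the unit circle, parametrised by $t\mapsto e^{it}$, and $dt^2$ is its standard metric of total length $2\pi$. A harmonic Riemannian submersion is a Riemannian submersion which is a harmonic map. *)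

theory Defs
  imports "HOL-Analysis.Analysis"
begin

section \<open>Smooth functions on open subsets of a Euclidean space\<close>

text \<open>Both notions are meant for open \<open>S\<close> only: the derivatives are two-sided.\<close>

primrec k_times_diff_on ::
  "nat \<Rightarrow> 'e::euclidean_space set \<Rightarrow> ('e \<Rightarrow> 'f::real_normed_vector) \<Rightarrow> bool" where
  "k_times_diff_on 0 S f \<longleftrightarrow> continuous_on S f"
| "k_times_diff_on (Suc k) S f \<longleftrightarrow>
     (\<forall>x\<in>S. f differentiable (at x)) \<and>
     (\<forall>v. k_times_diff_on k S (\<lambda>x. frechet_derivative f (at x) v))"

definition smooth_on :: "'e::euclidean_space set \<Rightarrow> ('e \<Rightarrow> 'f::real_normed_vector) \<Rightarrow> bool" where
  "smooth_on S f \<longleftrightarrow> (\<forall>k. k_times_diff_on k S f)"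

definition pderiv_at :: "'n::finite \<Rightarrow> (real^'n \<Rightarrow> 'f::real_normed_vector) \<Rightarrow> real^'n \<Rightarrow> 'f" where
  "pderiv_at i f x = frechet_derivative f (at x) (axis i 1)"


section \<open>Smooth and Riemannian manifolds\<close>

text \<open>A chart is a pair \<open>(U, f)\<close>; only the values of \<open>f\<close> on \<open>U\<close> are relevant.\<close>

type_synonym ('a, 'n) chart = "'a set \<times> ('a \<Rightarrow> real^'n)"

abbreviation chart_dom :: "('a, 'n::finite) chart \<Rightarrow> 'a set" where
  "chart_dom c \<equiv> fst c"

abbreviation chart_map :: "('a, 'n::finite) chart \<Rightarrow> 'a \<Rightarrow> real^'n" where
  "chart_map c \<equiv> snd c"

definition chart_img :: "('a, 'n::finite) chart \<Rightarrow> (real^'n) set" where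
  "chart_img c = chart_map c ` chart_dom c"

definition chart_inv :: "('a, 'n::finite) chart \<Rightarrow> real^'n \<Rightarrow> 'a" where
  "chart_inv c = inv_into (chart_dom c) (chart_map c)"

text \<open>
  The smooth structure on \<open>M\<close> (with the subspace topology) is the one generated by the atlas
  \<open>A\<close>, which need not be maximal. There is no boundary, since chart images are open in
  \<open>\<real>\<^sup>n\<close>.
\<close>

locale smooth_manifold =
  fixes M :: "'a::{t2_space, second_countable_topology} set"
    and A :: "('a, 'n::finite) chart set"
  assumes covers: "(\<Union>c\<in>A. chart_dom c) = M"
    and dom_open: "c \<in> A \<Longrightarrow> openin (top_of_set M) (chart_dom c)"
    and img_open: "c \<in> A \<Longrightarrow> open (chart_img c)"
    and chart_homeo:
      "c \<in> A \<Longrightarrow> homeomorphism (chart_dom c) (chart_img c) (chart_map c) (chart_inv c)"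
    and transition_smooth:
      "c \<in> A \<Longrightarrow> d \<in> A \<Longrightarrow>
         smooth_on (chart_map c ` (chart_dom c \<inter> chart_dom d)) (chart_map d \<circ> chart_inv c)"

text \<open>
  A metric is given by its Gram matrices: \<open>g c x\<close> is the matrix \<open>(g\<^sub>i\<^sub>j)\<close> with respect to the
  coordinate frame of the chart \<open>c\<close>, at the point with coordinates \<open>x\<close>. The axiom
  \<open>metric_transform\<close> is the transformation law of a symmetric covariant 2-tensor.
\<close>

type_synonym ('a, 'n) metric = "('a, 'n) chart \<Rightarrow> real^'n \<Rightarrow> real^'n^'n"

locale riemannian_manifold = smooth_manifold M A
  for M :: "'a::{t2_space, second_countable_topology} set"
    and A :: "('a, 'n::finite) chart set" +
  fixes g :: "('a, 'n) metric"
  assumes metric_smooth: "c \<in> A \<Longrightarrow> smooth_on (chart_img c) (g c)"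
    and metric_sym: "c \<in> A \<Longrightarrow> x \<in> chart_img c \<Longrightarrow> transpose (g c x) = g c x"
    and metric_pos: "c \<in> A \<Longrightarrow> x \<in> chart_img c \<Longrightarrow> v \<noteq> 0 \<Longrightarrow> v \<bullet> (g c x *v v) > 0"
    and metric_transform:
      "c \<in> A \<Longrightarrow> d \<in> A \<Longrightarrow> p \<in> chart_dom c \<inter> chart_dom d \<Longrightarrow>
       J = matrix (frechet_derivative (chart_map d \<circ> chart_inv c) (at (chart_map c p))) \<Longrightarrow>
       g c (chart_map c p) = transpose J ** g d (chart_map d p) ** J"

definition smooth_function ::
  "('a, 'n::finite) chart set \<Rightarrow> ('a \<Rightarrow> 'f::real_normed_vector) \<Rightarrow> bool" where
  "smooth_function A \<phi> \<longleftrightarrow> (\<forall>c\<in>A. smooth_on (chart_img c) (\<phi> \<circ> chart_inv c))"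

definition smooth_map ::
  "'a::topological_space set \<Rightarrow> ('a, 'n::finite) chart set \<Rightarrow>
   'b::topological_space set \<Rightarrow> ('b, 'm::finite) chart set \<Rightarrow> ('a \<Rightarrow> 'b) \<Rightarrow> bool" where
  "smooth_map M A N B F \<longleftrightarrow>
     F ` M \<subseteq> N \<and> continuous_on M F \<and>
     (\<forall>c\<in>A. \<forall>d\<in>B. smooth_on (chart_map c ` (chart_dom c \<inter> F -` chart_dom d))
                             (chart_map d \<circ> F \<circ> chart_inv c))"


section \<open>Gradient, divergence and eigenfunctions\<close>

text \<open>
  Sections of the complexified tangent bundle are handled through their components
  \<open>real^'n \<Rightarrow> complex^'n\<close> in a chart, and operators through their coordinate expressions;
  defining equations are imposed in every chart of the atlas.
\<close>

definition inv_metric :: "('a, 'n::finite) metric \<Rightarrow> ('a, 'n) chart \<Rightarrow> real^'n \<Rightarrow> real^'n^'n" where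
  "inv_metric g c x = matrix_inv (g c x)"

definition christoffel ::
  "('a, 'n::finite) metric \<Rightarrow> ('a, 'n) chart \<Rightarrow> 'n \<Rightarrow> 'n \<Rightarrow> 'n \<Rightarrow> real^'n \<Rightarrow> real" where
  "christoffel g c k i j x =
     (1/2) * (\<Sum>l\<in>UNIV. inv_metric g c x $ k $ l *
       (pderiv_at i (\<lambda>y. g c y $ j $ l) x + pderiv_at j (\<lambda>y. g c y $ i $ l) x
        - pderiv_at l (\<lambda>y. g c y $ i $ j) x))"

definition metric_C ::
  "('a, 'n::finite) metric \<Rightarrow> ('a, 'n) chart \<Rightarrow> real^'n \<Rightarrow> complex^'n \<Rightarrow> complex^'n \<Rightarrow> complex" where
  "metric_C g c x v w =
     (\<Sum>i\<in>UNIV. \<Sum>j\<in>UNIV. complex_of_real (g c x $ i $ j) * v $ i * w $ j)"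

definition gradient ::
  "('a, 'n::finite) metric \<Rightarrow> ('a, 'n) chart \<Rightarrow> ('a \<Rightarrow> complex) \<Rightarrow> real^'n \<Rightarrow> complex^'n" where
  "gradient g c \<phi> x =
     (\<chi> i. \<Sum>j\<in>UNIV. complex_of_real (inv_metric g c x $ i $ j) *
                    pderiv_at j (\<phi> \<circ> chart_inv c) x)"

text \<open>The divergence is the trace of \<open>\<nabla>X\<close> for the Levi-Civita connection.\<close>

definition divergence ::
  "('a, 'n::finite) metric \<Rightarrow> ('a, 'n) chart \<Rightarrow> (real^'n \<Rightarrow> complex^'n) \<Rightarrow> real^'n \<Rightarrow> complex" where
  "divergence g c X x =
     (\<Sum>i\<in>UNIV. pderiv_at i (\<lambda>y. X y $ i) x +
        (\<Sum>k\<in>UNIV. complex_of_real (christoffel g c i i k x) * X x $ k))"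

definition laplace_beltrami ::
  "('a, 'n::finite) metric \<Rightarrow> ('a, 'n) chart \<Rightarrow> ('a \<Rightarrow> complex) \<Rightarrow> real^'n \<Rightarrow> complex" where
  "laplace_beltrami g c \<phi> = divergence g c (gradient g c \<phi>)"

definition conformality ::
  "('a, 'n::finite) metric \<Rightarrow> ('a, 'n) chart \<Rightarrow> ('a \<Rightarrow> complex) \<Rightarrow> ('a \<Rightarrow> complex) \<Rightarrow>
   real^'n \<Rightarrow> complex" where
  "conformality g c \<phi> \<psi> x = metric_C g c x (gradient g c \<phi> x) (gradient g c \<psi> x)"

definition eigenfunction ::
  "('a, 'n::finite) chart set \<Rightarrow> ('a, 'n) metric \<Rightarrow> complex \<Rightarrow> complex \<Rightarrow> ('a \<Rightarrow> complex) \<Rightarrow> bool" where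
  "eigenfunction A g lam mu \<phi> \<longleftrightarrow>
     smooth_function A \<phi> \<and>
     (\<forall>c\<in>A. \<forall>p\<in>chart_dom c.
        laplace_beltrami g c \<phi> (chart_map c p) = lam * \<phi> p \<and>
        conformality g c \<phi> \<phi> (chart_map c p) = mu * (\<phi> p)\<^sup>2)"


section \<open>Harmonic Riemannian submersions\<close>

definition local_rep ::
  "('a, 'n::finite) chart \<Rightarrow> ('b, 'm::finite) chart \<Rightarrow> ('a \<Rightarrow> 'b) \<Rightarrow> real^'n \<Rightarrow> real^'m" where
  "local_rep c d F = chart_map d \<circ> F \<circ> chart_inv c"

text \<open>
  The component \<open>(\<nabla>dF)\<^sup>r\<^sub>i\<^sub>j\<close>, for the connection on \<open>T\<^sup>*M \<otimes> F\<^sup>-\<^sup>1TN\<close> induced by the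
  two Levi-Civita connections.
\<close>

definition second_fund_form ::
  "('a, 'n::finite) metric \<Rightarrow> ('b, 'm::finite) metric \<Rightarrow> ('a, 'n) chart \<Rightarrow> ('b, 'm) chart \<Rightarrow>
   ('a \<Rightarrow> 'b) \<Rightarrow> 'm \<Rightarrow> 'n \<Rightarrow> 'n \<Rightarrow> real^'n \<Rightarrow> real" where
  "second_fund_form g h c d F r i j x =
     (let f = (\<lambda>s y. local_rep c d F y $ s) in
       pderiv_at i (pderiv_at j (f r)) x
       - (\<Sum>k\<in>UNIV. christoffel g c k i j x * pderiv_at k (f r) x)
       + (\<Sum>s\<in>UNIV. \<Sum>t\<in>UNIV. christoffel h d r s t (local_rep c d F x) *
            pderiv_at i (f s) x * pderiv_at j (f t) x))"

definition tension_field ::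
  "('a, 'n::finite) metric \<Rightarrow> ('b, 'm::finite) metric \<Rightarrow> ('a, 'n) chart \<Rightarrow> ('b, 'm) chart \<Rightarrow>
   ('a \<Rightarrow> 'b) \<Rightarrow> real^'n \<Rightarrow> real^'m" where
  "tension_field g h c d F x =
     (\<chi> r. \<Sum>i\<in>UNIV. \<Sum>j\<in>UNIV. inv_metric g c x $ i $ j * second_fund_form g h c d F r i j x)"

definition harmonic_map ::
  "'a::topological_space set \<Rightarrow> ('a, 'n::finite) chart set \<Rightarrow> ('a, 'n) metric \<Rightarrow>
   'b::topological_space set \<Rightarrow> ('b, 'm::finite) chart set \<Rightarrow> ('b, 'm) metric \<Rightarrow> ('a \<Rightarrow> 'b) \<Rightarrow> bool" where
  "harmonic_map M A g N B h F \<longleftrightarrow>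
     smooth_map M A N B F \<and>
     (\<forall>c\<in>A. \<forall>d\<in>B. \<forall>p \<in> chart_dom c \<inter> F -` chart_dom d.
        tension_field g h c d F (chart_map c p) = 0)"

text \<open>
  \<open>H\<close> below is the horizontal space, the \<open>g\<close>-orthogonal complement of the kernel of the
  differential \<open>D\<close>.
\<close>

definition riemannian_submersion ::
  "'a::topological_space set \<Rightarrow> ('a, 'n::finite) chart set \<Rightarrow> ('a, 'n) metric \<Rightarrow>
   'b::topological_space set \<Rightarrow> ('b, 'm::finite) chart set \<Rightarrow> ('b, 'm) metric \<Rightarrow> ('a \<Rightarrow> 'b) \<Rightarrow> bool" where
  "riemannian_submersion M A g N B h F \<longleftrightarrow>
     smooth_map M A N B F \<and> F ` M = N \<and>
     (\<forall>c\<in>A. \<forall>d\<in>B. \<forall>p \<in> chart_dom c \<inter> F -` chart_dom d.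
        let G = g c (chart_map c p);
            K = h d (chart_map d (F p));
            D = frechet_derivative (local_rep c d F) (at (chart_map c p));
            H = {v. \<forall>u. D u = 0 \<longrightarrow> v \<bullet> (G *v u) = 0}
        in surj D \<and> (\<forall>v\<in>H. \<forall>w\<in>H. D v \<bullet> (K *v D w) = v \<bullet> (G *v w)))"

definition harmonic_riemannian_submersion ::
  "'a::topological_space set \<Rightarrow> ('a, 'n::finite) chart set \<Rightarrow> ('a, 'n) metric \<Rightarrow>
   'b::topological_space set \<Rightarrow> ('b, 'm::finite) chart set \<Rightarrow> ('b, 'm) metric \<Rightarrow> ('a \<Rightarrow> 'b) \<Rightarrow> bool" where
  "harmonic_riemannian_submersion M A g N B h F \<longleftrightarrow>
     riemannian_submersion M A g N B h F \<and> harmonic_map M A g N B h F"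


section \<open>The circle\<close>

abbreviation circle :: "complex set" where
  "circle \<equiv> sphere 0 1"

text \<open>
  The charts are the local inverses of \<open>t \<mapsto> exp(it)\<close> on the intervals
  \<open>(a, a + 2\<pi>)\<close>; \<open>vec\<close> identifies \<open>real\<close> with \<open>real^1\<close>. In each of them the
  Gram matrix of \<open>r dt\<^sup>2\<close> is the constant \<open>r\<close>.
\<close>

definition angle_chart :: "real \<Rightarrow> (complex, 1) chart" where
  "angle_chart a =
     (cis ` {a<..<a + 2 * pi}, \<lambda>z. vec (inv_into {a<..<a + 2 * pi} cis z))"

definition circle_atlas :: "(complex, 1) chart set" where
  "circle_atlas = range angle_chart"

definition circle_metric :: "real \<Rightarrow> (complex, 1) metric" where
  "circle_metric r = (\<lambda>c x. r *\<^sub>R mat 1)"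

end

(*
  In a chart, tau is L = a^ij d_i d_j + b^k d_k with a the inverse metric. For (i) ==> (ii), write
  phi = p + i q. The equations give |grad p|^2 - |grad q|^2 = lam (p^2 - q^2) and
  <grad p, grad q> = lam p q, so by Cauchy-Schwarz |grad p|^2 + |grad q|^2 >= -lam |phi|^2, that is,
  L |phi|^2 >= 0. By Hopf's strong maximum principle |phi| is constant.

  Once |phi| = rho is constant, phi = rho cis theta locally, and
    tau phi = phi (i L theta - |grad theta|^2),   kappa(phi, phi) = - phi^2 |grad theta|^2,
  so phi is a (lam, lam)-eigenfunction iff L theta = 0 (harmonicity of the map to the circle) and
  |grad theta|^2 = |lam| (the submersion condition). The map is onto the circle, since otherwise
  theta could be chosen globally and would be critical at its maximum.
*)
theory Submission
  imports Defs
begin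

subsection \<open>Calculus of smooth functions\<close>

text \<open>The modulus enters squared because phi may have zeros until its constancy is known, and
  |phi| need not be smooth there. The maximum principle is proved for operators with merely
  continuous coefficients on open subsets of \<open>real^'n\<close>. A chart provides such data once
  tau, defined as a divergence, is rewritten as a second order operator; this is the main
  computation, since it differentiates the inverse metric and contracts the Christoffel symbols. The
  same operator acts on local angles, because in the angle charts the circle metric is constant and
  the target connection drops out of the tension field. An angle exists only off one omitted point,
  so the conditions on the circle map are quantified over all angle charts, which the eigenfunction
  equations do not mention; every point of the circle lies in some such chart, and this carries the
  pointwise equivalence across. In (ii) ==> (i) the constancy of |phi| is just the statement that
  the map takes values in the circle. Compactness serves twice: for the maximum of |phi|^2 and for
  that of a global angle.\<close>

lemma frechet_derivative_cong_open:
  assumes "open S" "x \<in> S" "\<And>y. y \<in> S \<Longrightarrow> f y = h y"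
  shows "frechet_derivative f (at x) = frechet_derivative h (at x)"
proof -
  \<comment> \<open>\<open>frechet_derivative\<close> is a choice from this predicate, so equal
    predicates give equal choices, differentiable or not.\<close>
  have "(f has_derivative D) (at x) \<longleftrightarrow> (h has_derivative D) (at x)" for D
    using assms has_derivative_transform_within_open by (metis (no_types, lifting))
  then show ?thesis unfolding frechet_derivative_def by simp
qed

lemma differentiable_cong_open:
  assumes "open S" "x \<in> S" "\<And>y. y \<in> S \<Longrightarrow> f y = h y"
  shows "f differentiable (at x) \<longleftrightarrow> h differentiable (at x)"
  unfolding differentiable_def
  using assms has_derivative_transform_within_open by (metis (no_types, lifting))

lemma k_times_diff_on_cong:
  assumes "open S" "\<And>x. x \<in> S \<Longrightarrow> f x = h x"
  shows "k_times_diff_on k S f \<longleftrightarrow> k_times_diff_on k S h"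
  using assms(2)
proof (induction k arbitrary: f h)
  case 0
  then show ?case by (simp cong: continuous_on_cong)
next
  case (Suc k)
  have "f differentiable (at x) \<longleftrightarrow> h differentiable (at x)" if "x \<in> S" for x
    using differentiable_cong_open[OF assms(1) that Suc.prems] .
  moreover have "k_times_diff_on k S (\<lambda>x. frechet_derivative f (at x) v)
      \<longleftrightarrow> k_times_diff_on k S (\<lambda>x. frechet_derivative h (at x) v)" for v
    by (rule Suc.IH) (simp add: frechet_derivative_cong_open[OF assms(1) _ Suc.prems])
  ultimately show ?case by simp
qed

text \<open>Differentiability supplies the continuity, which the definition asks for only at order
  0.\<close>

lemma k_times_diff_on_Suc_imp: "k_times_diff_on (Suc k) S f \<Longrightarrow> k_times_diff_on k S f"
proof (induction k arbitrary: f)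
  case 0
  then show ?case
    by (auto intro!: continuous_at_imp_continuous_on differentiable_imp_continuous_within)
next
  case (Suc k)
  then show ?case by (metis k_times_diff_on.simps(2))
qed

lemma k_times_diff_on_subset: "k_times_diff_on k S f \<Longrightarrow> T \<subseteq> S \<Longrightarrow> k_times_diff_on k T f"
  by (induction k arbitrary: f) (auto intro: continuous_on_subset)

lemma k_times_diff_on_const: "k_times_diff_on k S (\<lambda>x. c)"
  by (induction k arbitrary: c) (auto)

lemma k_times_diff_on_add:
  assumes "open S"
  shows "k_times_diff_on k S f \<Longrightarrow> k_times_diff_on k S h \<Longrightarrow> k_times_diff_on k S (\<lambda>x. f x + h x)"
proof (induction k arbitrary: f h)
  case 0
  then show ?case by (simp add: continuous_on_add)
next
  case (Suc k)
  have "k_times_diff_on k S (\<lambda>x. frechet_derivative (\<lambda>x. f x + h x) (at x) v)" for v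
  proof -
    have "frechet_derivative (\<lambda>x. f x + h x) (at x) v
        = frechet_derivative f (at x) v + frechet_derivative h (at x) v" if "x \<in> S" for x
      using Suc.prems that
      by (intro frechet_derivative_at[OF has_derivative_add, symmetric, THEN fun_cong]
          frechet_derivative_works[THEN iffD1]) auto
    moreover have "k_times_diff_on k S (\<lambda>x. frechet_derivative f (at x) v + frechet_derivative h (at x) v)"
      using Suc by simp
    ultimately show ?thesis
      by (subst k_times_diff_on_cong[OF assms])
  qed
  with Suc.prems show ?case by simp
qed

text \<open>Any bounded bilinear map is allowed, so that multiplication and the inner product are
  covered at once.\<close>

lemma k_times_diff_on_bounded_bilinear:
  assumes "open S" "bounded_bilinear B"
  shows "k_times_diff_on k S f \<Longrightarrow> k_times_diff_on k S h
    \<Longrightarrow> k_times_diff_on k S (\<lambda>x. B (f x) (h x))"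
proof (induction k arbitrary: f h)
  case 0
  then show ?case using assms(2) by (simp add: bounded_bilinear.continuous_on)
next
  case (Suc k)
  have D: "((\<lambda>x. B (f x) (h x)) has_derivative
      (\<lambda>v. B (f x) (frechet_derivative h (at x) v) + B (frechet_derivative f (at x) v) (h x))) (at x)"
    if "x \<in> S" for x
  proof -
    have "f differentiable at x" "h differentiable at x" using Suc.prems that by auto
    then show ?thesis
      by (intro bounded_bilinear.FDERIV[OF assms(2)] frechet_derivative_works[THEN iffD1])
  qed
  have "k_times_diff_on k S (\<lambda>x. frechet_derivative (\<lambda>x. B (f x) (h x)) (at x) v)" for v
  proof -
    have "frechet_derivative (\<lambda>x. B (f x) (h x)) (at x) v
       = B (f x) (frechet_derivative h (at x) v) + B (frechet_derivative f (at x) v) (h x)"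
      if "x \<in> S" for x
      using frechet_derivative_at[OF D[OF that]] by metis
    \<comment> \<open>The Leibniz rule leaves one factor undifferentiated; that factor is used at
      one order less than is available.\<close>
    moreover have "k_times_diff_on k S (\<lambda>x. B (f x) (frechet_derivative h (at x) v)
          + B (frechet_derivative f (at x) v) (h x))"
      using Suc.prems k_times_diff_on_Suc_imp[OF Suc.prems(1)] k_times_diff_on_Suc_imp[OF Suc.prems(2)]
      by (intro k_times_diff_on_add assms(1) Suc.IH) auto
    ultimately show ?thesis
      by (subst k_times_diff_on_cong[OF assms(1)])
  qed
  then show ?case using D by (auto simp: differentiable_def)
qed

lemma k_times_diff_on_bounded_linear_compose:
  assumes "open S" "bounded_linear L"
  shows "k_times_diff_on k S f \<Longrightarrow> k_times_diff_on k S (\<lambda>x. L (f x))"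
proof (induction k arbitrary: f)
  case 0
  then show ?case using assms(2) by (simp add: bounded_linear.continuous_on)
next
  case (Suc k)
  have D: "((\<lambda>x. L (f x)) has_derivative (\<lambda>v. L (frechet_derivative f (at x) v))) (at x)"
    if "x \<in> S" for x
  proof -
    have "f differentiable at x" using Suc.prems that by auto
    then show ?thesis
      using bounded_linear.has_derivative[OF assms(2)] frechet_derivative_works by blast
  qed
  have "k_times_diff_on k S (\<lambda>x. frechet_derivative (\<lambda>x. L (f x)) (at x) v)" for v
  proof -
    have "frechet_derivative (\<lambda>x. L (f x)) (at x) v = L (frechet_derivative f (at x) v)"
      if "x \<in> S" for x
      using frechet_derivative_at[OF D[OF that]] by metis
    then show ?thesis
      using Suc by (subst k_times_diff_on_cong[OF assms(1)]) auto
  qed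
  then show ?case using D by (auto simp: differentiable_def)
qed

lemma smooth_on_cong:
  "open S \<Longrightarrow> (\<And>x. x \<in> S \<Longrightarrow> f x = h x) \<Longrightarrow> smooth_on S f \<longleftrightarrow> smooth_on S h"
  unfolding smooth_on_def using k_times_diff_on_cong by blast

lemma smooth_on_subset: "smooth_on S f \<Longrightarrow> T \<subseteq> S \<Longrightarrow> smooth_on T f"
  unfolding smooth_on_def using k_times_diff_on_subset by blast

lemma smooth_on_const: "smooth_on S (\<lambda>x. c)"
  unfolding smooth_on_def using k_times_diff_on_const by blast

lemma smooth_on_add:
  "open S \<Longrightarrow> smooth_on S f \<Longrightarrow> smooth_on S h \<Longrightarrow> smooth_on S (\<lambda>x. f x + h x)"
  unfolding smooth_on_def using k_times_diff_on_add by blast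

lemma smooth_on_bounded_bilinear:
  "open S \<Longrightarrow> bounded_bilinear B \<Longrightarrow> smooth_on S f \<Longrightarrow> smooth_on S h
    \<Longrightarrow> smooth_on S (\<lambda>x. B (f x) (h x))"
  unfolding smooth_on_def using k_times_diff_on_bounded_bilinear by blast

lemma smooth_on_bounded_linear_compose:
  "open S \<Longrightarrow> bounded_linear L \<Longrightarrow> smooth_on S f \<Longrightarrow> smooth_on S (\<lambda>x. L (f x))"
  unfolding smooth_on_def using k_times_diff_on_bounded_linear_compose by blast

lemmas smooth_on_mult = smooth_on_bounded_bilinear[OF _ bounded_bilinear_mult]

lemma smooth_on_imp_differentiable: "smooth_on S f \<Longrightarrow> x \<in> S \<Longrightarrow> f differentiable (at x)"
  unfolding smooth_on_def by (metis k_times_diff_on.simps(2))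

lemma smooth_on_imp_continuous_on: "smooth_on S f \<Longrightarrow> continuous_on S f"
  unfolding smooth_on_def by (metis k_times_diff_on.simps(1))

lemma smooth_on_frechet_derivative:
  "smooth_on S f \<Longrightarrow> smooth_on S (\<lambda>x. frechet_derivative f (at x) v)"
  unfolding smooth_on_def by (metis k_times_diff_on.simps(2))

lemma smooth_on_pderiv_at: "smooth_on S f \<Longrightarrow> smooth_on S (pderiv_at j f)"
  unfolding pderiv_at_def by (rule smooth_on_frechet_derivative)

text \<open>Order k + 1 of \<open>f\<close> is order k of its derivatives, and it implies order k of
  \<open>f\<close>. This serves functions with an explicit derivative: linear maps and
  angles.\<close>

lemma smooth_onI:
  assumes "\<And>x. x \<in> S \<Longrightarrow> f differentiable (at x)"
    and "\<And>v. smooth_on S (\<lambda>x. frechet_derivative f (at x) v)"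
  shows "smooth_on S f"
  unfolding smooth_on_def
proof
  fix k
  have "k_times_diff_on (Suc k) S f" using assms by (simp add: smooth_on_def)
  then show "k_times_diff_on k S f" by (rule k_times_diff_on_Suc_imp)
qed

lemma smooth_on_bounded_linear:
  assumes "bounded_linear L"
  shows "smooth_on S L"
proof (rule smooth_onI)
  show "L differentiable at x" for x
    using assms bounded_linear_imp_differentiable by blast
  show "smooth_on S (\<lambda>x. frechet_derivative L (at x) v)" for v
    using frechet_derivative_at[OF bounded_linear_imp_has_derivative[OF assms], symmetric]
    by (simp add: smooth_on_const)
qed

section \<open>Coordinate derivatives and their rules\<close>

lemma frechet_derivative_eq_sum_pderiv:
  fixes f :: "real^'n \<Rightarrow> 'f::real_normed_vector"
  assumes "f differentiable (at x)"
  shows "frechet_derivative f (at x) v = (\<Sum>i\<in>UNIV. v $ i *\<^sub>R pderiv_at i f x)"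
proof -
  have lin: "linear (frechet_derivative f (at x))"
    using assms linear_frechet_derivative by blast
  have "frechet_derivative f (at x) v = frechet_derivative f (at x) (\<Sum>i\<in>UNIV. v $ i *\<^sub>R axis i 1)"
    by (simp add: basis_expansion scalar_mult_eq_scaleR[symmetric])
  also have "\<dots> = (\<Sum>i\<in>UNIV. v $ i *\<^sub>R frechet_derivative f (at x) (axis i 1))"
    using lin by (simp add: linear_sum linear_scale)
  finally show ?thesis by (simp add: pderiv_at_def)
qed

lemma pderiv_at_eqI: "(f has_derivative D) (at x) \<Longrightarrow> pderiv_at i f x = D (axis i 1)"
  unfolding pderiv_at_def using frechet_derivative_at by metis

lemma pderiv_at_cong_open:
  "open S \<Longrightarrow> x \<in> S \<Longrightarrow> (\<And>y. y \<in> S \<Longrightarrow> f y = h y) \<Longrightarrow> pderiv_at i f x = pderiv_at i h x"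
  unfolding pderiv_at_def using frechet_derivative_cong_open by metis

lemma pderiv_at_const: "pderiv_at i (\<lambda>x. c) x = 0"
  by (simp add: pderiv_at_def frechet_derivative_const)

lemma pderiv_at_add:
  "f differentiable (at x) \<Longrightarrow> h differentiable (at x) \<Longrightarrow>
    pderiv_at i (\<lambda>x. f x + h x) x = pderiv_at i f x + pderiv_at i h x"
  unfolding frechet_derivative_works
  by (drule (1) has_derivative_add, drule pderiv_at_eqI) (simp add: pderiv_at_def)

lemma pderiv_at_sum:
  assumes "finite I" "\<And>k. k \<in> I \<Longrightarrow> f k differentiable (at x)"
  shows "pderiv_at i (\<lambda>x. \<Sum>k\<in>I. f k x) x = (\<Sum>k\<in>I. pderiv_at i (f k) x)"
  using assms by induction (simp_all add: pderiv_at_const pderiv_at_add differentiable_sum)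

lemma pderiv_at_bounded_bilinear:
  "bounded_bilinear B \<Longrightarrow> f differentiable (at x) \<Longrightarrow> h differentiable (at x) \<Longrightarrow>
    pderiv_at i (\<lambda>x. B (f x) (h x)) x = B (f x) (pderiv_at i h x) + B (pderiv_at i f x) (h x)"
  unfolding frechet_derivative_works
  by (drule (2) bounded_bilinear.FDERIV, drule pderiv_at_eqI) (simp add: pderiv_at_def)

lemmas pderiv_at_mult = pderiv_at_bounded_bilinear[OF bounded_bilinear_mult]

lemma pderiv_at_bounded_linear:
  "bounded_linear L \<Longrightarrow> f differentiable (at x) \<Longrightarrow>
    pderiv_at i (\<lambda>x. L (f x)) x = L (pderiv_at i f x)"
  unfolding frechet_derivative_works
  by (drule (1) bounded_linear.has_derivative, drule pderiv_at_eqI) (simp add: pderiv_at_def)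

subsection \<open>Second order operators\<close>

text \<open>The coefficients are frozen at the point, so the algebraic rules below demand no
  regularity of them. Values in any normed space let the same operator act on phi, on its real and
  imaginary parts, and on angles.\<close>

definition second_order_op ::
  "real^'n^'n \<Rightarrow> real^'n \<Rightarrow> (real^'n \<Rightarrow> 'f::real_normed_vector) \<Rightarrow> real^'n \<Rightarrow> 'f" where
  "second_order_op a b u x =
     (\<Sum>i\<in>UNIV. \<Sum>j\<in>UNIV. a $ i $ j *\<^sub>R pderiv_at i (pderiv_at j u) x)
     + (\<Sum>k\<in>UNIV. b $ k *\<^sub>R pderiv_at k u x)"

text \<open>For \<open>a\<close> the inverse metric this is g(grad u, grad v) in coordinates,
  complex bilinear when the functions are complex.\<close>

definition gradient_product ::
  "real^'n^'n \<Rightarrow> (real^'n \<Rightarrow> 'f::real_normed_algebra) \<Rightarrow> (real^'n \<Rightarrow> 'f) \<Rightarrow> real^'n \<Rightarrow> 'f" where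
  "gradient_product a u v x =
     (\<Sum>i\<in>UNIV. \<Sum>j\<in>UNIV. a $ i $ j *\<^sub>R (pderiv_at i u x * pderiv_at j v x))"

lemma second_order_op_add:
  assumes "open S" "x \<in> S" "smooth_on S u" "smooth_on S w"
  shows "second_order_op a b (\<lambda>x. u x + w x) x = second_order_op a b u x + second_order_op a b w x"
proof -
  have 1: "pderiv_at j (\<lambda>x. u x + w x) y = pderiv_at j u y + pderiv_at j w y" if "y \<in> S" for j y
    using assms that by (simp add: pderiv_at_add smooth_on_imp_differentiable)
  have 2: "pderiv_at i (pderiv_at j (\<lambda>x. u x + w x)) x
      = pderiv_at i (pderiv_at j u) x + pderiv_at i (pderiv_at j w) x" for i j
    using assms pderiv_at_cong_open[OF assms(1,2) 1]
    by (simp add: pderiv_at_add smooth_on_imp_differentiable[of S] smooth_on_pderiv_at)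
  show ?thesis
    using assms(2) by (simp add: second_order_op_def 1 2 scaleR_right_distrib sum.distrib)
qed

lemma second_order_op_bounded_linear:
  assumes "open S" "x \<in> S" "smooth_on S u" "bounded_linear L"
  shows "second_order_op a b (\<lambda>x. L (u x)) x = L (second_order_op a b u x)"
proof -
  interpret bounded_linear L by fact
  have 1: "pderiv_at j (\<lambda>x. L (u x)) y = L (pderiv_at j u y)" if "y \<in> S" for j y
    using assms that by (simp add: pderiv_at_bounded_linear smooth_on_imp_differentiable)
  have 2: "pderiv_at i (pderiv_at j (\<lambda>x. L (u x))) x = L (pderiv_at i (pderiv_at j u) x)" for i j
    using assms pderiv_at_cong_open[OF assms(1,2) 1]
    by (simp add: pderiv_at_bounded_linear smooth_on_imp_differentiable[of S] smooth_on_pderiv_at)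
  show ?thesis
    using assms(2) by (simp add: second_order_op_def 1 2 add sum scaleR)
qed

text \<open>Symmetry of \<open>a\<close> makes the two mixed first derivative sums equal, whence the
  factor 2.\<close>

lemma second_order_op_mult:
  fixes u w :: "real^'n \<Rightarrow> 'f::real_normed_field"
  assumes "open S" "x \<in> S" "smooth_on S u" "smooth_on S w" "transpose a = a"
  shows "second_order_op a b (\<lambda>x. u x * w x) x
    = u x * second_order_op a b w x + w x * second_order_op a b u x + 2 * gradient_product a u w x"
proof -
  have 1: "pderiv_at j (\<lambda>x. u x * w x) y = u y * pderiv_at j w y + pderiv_at j u y * w y"
    if "y \<in> S" for j y
    using assms that by (simp add: pderiv_at_mult smooth_on_imp_differentiable)
  have 2: "pderiv_at i (pderiv_at j (\<lambda>x. u x * w x)) x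
      = (u x * pderiv_at i (pderiv_at j w) x + w x * pderiv_at i (pderiv_at j u) x)
        + (pderiv_at i u x * pderiv_at j w x + pderiv_at j u x * pderiv_at i w x)" for i j
    using assms pderiv_at_cong_open[OF assms(1,2) 1]
    by (simp add: pderiv_at_mult pderiv_at_add smooth_on_imp_differentiable[of S] smooth_on_pderiv_at
        algebra_simps)
  have a: "a $ i $ j = a $ j $ i" for i j
    using assms(5) by (metis transpose_def vec_lambda_beta)
  have 3: "(\<Sum>i\<in>UNIV. \<Sum>j\<in>UNIV. a $ i $ j *\<^sub>R (pderiv_at j u x * pderiv_at i w x))
      = gradient_product a u w x"
    unfolding gradient_product_def by (subst sum.swap) (simp add: a)
  have 4: "(\<Sum>i\<in>UNIV. \<Sum>j\<in>UNIV. a $ i $ j *\<^sub>R (z * f i j)) = z * (\<Sum>i\<in>UNIV. \<Sum>j\<in>UNIV. a $ i $ j *\<^sub>R f i j)"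
    for f and z :: 'f
    by (simp add: sum_distrib_left)
  have "(\<Sum>i\<in>UNIV. \<Sum>j\<in>UNIV. a $ i $ j *\<^sub>R pderiv_at i (pderiv_at j (\<lambda>x. u x * w x)) x)
    = u x * (\<Sum>i\<in>UNIV. \<Sum>j\<in>UNIV. a $ i $ j *\<^sub>R pderiv_at i (pderiv_at j w) x)
      + w x * (\<Sum>i\<in>UNIV. \<Sum>j\<in>UNIV. a $ i $ j *\<^sub>R pderiv_at i (pderiv_at j u) x)
      + (gradient_product a u w x + gradient_product a u w x)"
    unfolding 2 scaleR_right_distrib sum.distrib 3 4 by (simp only: gradient_product_def)
  moreover have "(\<Sum>k\<in>UNIV. b $ k *\<^sub>R pderiv_at k (\<lambda>x. u x * w x) x)
    = u x * (\<Sum>k\<in>UNIV. b $ k *\<^sub>R pderiv_at k w x) + w x * (\<Sum>k\<in>UNIV. b $ k *\<^sub>R pderiv_at k u x)"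
    unfolding 1[OF assms(2)] scaleR_right_distrib sum.distrib sum_distrib_left
    by (simp add: mult.commute)
  ultimately show ?thesis
    by (simp add: second_order_op_def distrib_left)
qed

subsection \<open>Symmetric positive semidefinite matrices\<close>

lemma inner_matrix_vector_mult_eq_sum:
  "v \<bullet> ((a::real^'n^'n) *v w) = (\<Sum>i\<in>UNIV. \<Sum>j\<in>UNIV. a $ i $ j * (v $ i * w $ j))"
  by (simp add: inner_vec_def matrix_vector_mult_def sum_distrib_left mult.left_commute)

lemma inner_matrix_vector_mult_commute:
  "transpose a = a \<Longrightarrow> v \<bullet> ((a::real^'n^'n) *v w) = w \<bullet> (a *v v)"
  by (metis dot_lmul_matrix inner_commute transpose_matrix_vector)

text \<open>The quadratic form at v + t w is a nonnegative polynomial in t. It may degenerate to an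
  affine one, as semidefiniteness is all that survives the rank one reduction of the trace
  inequality below.\<close>

lemma psd_Cauchy_Schwarz:
  fixes a :: "real^'n^'n"
  assumes sym: "transpose a = a" and psd: "\<And>v. 0 \<le> v \<bullet> (a *v v)"
  shows "(v \<bullet> (a *v w))\<^sup>2 \<le> (v \<bullet> (a *v v)) * (w \<bullet> (a *v w))"
proof -
  define B where "B = v \<bullet> (a *v w)"
  have exp: "(v + t *\<^sub>R w) \<bullet> (a *v (v + t *\<^sub>R w))
      = v \<bullet> (a *v v) + 2 * t * B + t\<^sup>2 * (w \<bullet> (a *v w))" for t
    using inner_matrix_vector_mult_commute[OF sym, of w v]
    by (simp add: B_def matrix_vector_right_distrib matrix_vector_mult_scaleR inner_add_left
        inner_add_right power2_eq_square algebra_simps)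
  have nn: "0 \<le> v \<bullet> (a *v v) + 2 * t * B + t\<^sup>2 * (w \<bullet> (a *v w))" for t
    using psd[of "v + t *\<^sub>R w"] unfolding exp .
  show ?thesis
  proof (cases "w \<bullet> (a *v w) = 0")
    case True
    have "B = 0"
    proof (rule ccontr)
      assume "B \<noteq> 0"
      \<comment> \<open>At this t the affine polynomial takes the value -1.\<close>
      then show False using nn[of "- (v \<bullet> (a *v v) + 1) / (2 * B)"] True by (simp add: field_simps)
    qed
    then show ?thesis using True by (simp add: B_def)
  next
    case False
    then have pos: "0 < w \<bullet> (a *v w)" using psd[of w] by simp
    show ?thesis
      \<comment> \<open>This t minimises the quadratic polynomial.\<close>
      using nn[of "- B / (w \<bullet> (a *v w))"] pos
      by (simp add: B_def[symmetric] power2_eq_square field_simps)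
  qed
qed

lemma inner_axis_matrix: "axis k 1 \<bullet> ((a::real^'n^'n) *v v) = (\<Sum>j\<in>UNIV. a $ k $ j * v $ j)"
  by (simp add: inner_axis' matrix_vector_mult_def)

lemma axis_matrix_axis: "axis k 1 \<bullet> ((a::real^'n^'n) *v axis l 1) = a $ k $ l"
  by (simp add: inner_axis' matrix_vector_mul_component inner_axis)

text \<open>Subtracting the rank one matrix \<open>a\<^sub>k a\<^sub>k\<^sup>T / a\<^sub>k\<^sub>k\<close> keeps \<open>a\<close> positive semidefinite
  and lowers the number of its nonzero diagonal entries.\<close>

lemma psd_nsd_trace_le_0:
  fixes a :: "real^'n^'n" and H :: "'n \<Rightarrow> 'n \<Rightarrow> real"
  assumes "transpose a = a" "\<And>v. 0 \<le> v \<bullet> (a *v v)"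
    and H: "\<And>v::real^'n. (\<Sum>i\<in>UNIV. \<Sum>j\<in>UNIV. v $ i * v $ j * H i j) \<le> 0"
  shows "(\<Sum>i\<in>UNIV. \<Sum>j\<in>UNIV. a $ i $ j * H i j) \<le> 0"
  using assms(1,2)
proof (induction "card {i. a $ i $ i \<noteq> 0}" arbitrary: a rule: less_induct)
  case less
  \<comment> \<open>A zero diagonal entry kills its whole row. Hence the reduction creates no new
    nonzero diagonal entry, and a matrix whose diagonal vanishes is zero.\<close>
  have zero: "a $ i $ j = 0" if "a $ i $ i = 0" for i j
  proof -
    have "(a $ i $ j)\<^sup>2 \<le> a $ i $ i * a $ j $ j"
      using psd_Cauchy_Schwarz[OF less.prems, of "axis i 1" "axis j 1"] by (simp add: axis_matrix_axis)
    then show ?thesis using that by simp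
  qed
  have sym: "a $ i $ j = a $ j $ i" for i j
    using less.prems(1) by (metis transpose_def vec_lambda_beta)
  show ?case
  proof (cases "\<exists>k. a $ k $ k \<noteq> 0")
    case False
    then show ?thesis using zero by simp
  next
    case True
    then obtain k where k: "a $ k $ k \<noteq> 0" by blast
    then have kpos: "a $ k $ k > 0"
      using less.prems(2)[of "axis k 1"] by (simp add: axis_matrix_axis)
    define a' :: "real^'n^'n" where "a' = (\<chi> i j. a $ i $ j - a $ k $ i * a $ k $ j / a $ k $ k)"
    have quad: "v \<bullet> (a' *v v) = v \<bullet> (a *v v) - (axis k 1 \<bullet> (a *v v))\<^sup>2 / a $ k $ k" for v
    proof -
      have "(axis k 1 \<bullet> (a *v v))\<^sup>2 / a $ k $ k
          = (\<Sum>i\<in>UNIV. \<Sum>j\<in>UNIV. (a $ k $ i * a $ k $ j / a $ k $ k) * (v $ i * v $ j))"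
        unfolding inner_axis_matrix power2_eq_square sum_product sum_divide_distrib
        by (intro sum.cong refl) (simp add: mult_ac)
      then show ?thesis
        by (simp add: inner_matrix_vector_mult_eq_sum a'_def left_diff_distrib sum_subtractf)
    qed
    have "{i. a' $ i $ i \<noteq> 0} \<subset> {i. a $ i $ i \<noteq> 0}"
    proof
      show "{i. a' $ i $ i \<noteq> 0} \<subseteq> {i. a $ i $ i \<noteq> 0}"
        using zero sym by (auto simp: a'_def)
      have "k \<notin> {i. a' $ i $ i \<noteq> 0}" using k by (simp add: a'_def)
      then show "{i. a' $ i $ i \<noteq> 0} \<noteq> {i. a $ i $ i \<noteq> 0}" using k by blast
    qed
    then have "card {i. a' $ i $ i \<noteq> 0} < card {i. a $ i $ i \<noteq> 0}"
      by (simp add: psubset_card_mono)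
    moreover have "transpose a' = a'"
      using sym by (auto simp: a'_def transpose_def vec_eq_iff mult.commute intro!: arg_cong2[of _ _ _ _ minus])
    \<comment> \<open>By \<open>quad\<close> this is exactly Cauchy-Schwarz for v and the k-th basis
      vector.\<close>
    moreover have "0 \<le> v \<bullet> (a' *v v)" for v
      using psd_Cauchy_Schwarz[OF less.prems, of "axis k 1" v] kpos
      by (simp add: quad axis_matrix_axis field_simps)
    ultimately have "(\<Sum>i\<in>UNIV. \<Sum>j\<in>UNIV. a' $ i $ j * H i j) \<le> 0"
      using less.hyps by blast
    moreover have "(\<Sum>i\<in>UNIV. \<Sum>j\<in>UNIV. a $ i $ j * H i j) = (\<Sum>i\<in>UNIV. \<Sum>j\<in>UNIV. a' $ i $ j * H i j)
        + (\<Sum>i\<in>UNIV. \<Sum>j\<in>UNIV. (a $ k) $ i * (a $ k) $ j * H i j) / a $ k $ k"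
      unfolding sum_divide_distrib sum.distrib[symmetric]
      by (intro sum.cong refl) (simp add: a'_def left_diff_distrib)
    moreover have "(\<Sum>i\<in>UNIV. \<Sum>j\<in>UNIV. (a $ k) $ i * (a $ k) $ j * H i j) / a $ k $ k \<le> 0"
      using H[of "a $ k"] kpos by (simp add: divide_nonpos_pos)
    ultimately show ?thesis by linarith
  qed
qed

subsection \<open>The maximum principle\<close>

lemma has_real_derivative_along_line:
  fixes F :: "real^'n \<Rightarrow> real"
  assumes "F differentiable (at (x + t *\<^sub>R v))"
  shows "((\<lambda>t. F (x + t *\<^sub>R v)) has_real_derivative (\<Sum>j\<in>UNIV. v $ j * pderiv_at j F (x + t *\<^sub>R v))) (at t)"
proof -
  have 1: "(F has_derivative frechet_derivative F (at (x + t *\<^sub>R v))) (at (x + t *\<^sub>R v))"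
    using assms frechet_derivative_works by blast
  have 2: "((\<lambda>t. x + t *\<^sub>R v) has_derivative (\<lambda>s. s *\<^sub>R v)) (at t)"
    by (auto intro!: derivative_eq_intros)
  have "((\<lambda>t. F (x + t *\<^sub>R v)) has_derivative (\<lambda>s. frechet_derivative F (at (x + t *\<^sub>R v)) (s *\<^sub>R v))) (at t)"
    using diff_chain_at[OF 2 1] by (simp add: o_def)
  moreover have "frechet_derivative F (at (x + t *\<^sub>R v)) (s *\<^sub>R v)
      = (\<Sum>j\<in>UNIV. v $ j * pderiv_at j F (x + t *\<^sub>R v)) * s" for s
    by (simp add: frechet_derivative_eq_sum_pderiv[OF assms] sum_distrib_left mult_ac)
  ultimately show ?thesis by (simp add: has_field_derivative_def)
qed

lemma interior_max_imp_pderiv_eq_0: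
  fixes F :: "real^'n \<Rightarrow> real"
  assumes "open S" "x \<in> S" "F differentiable (at x)" "\<And>y. y \<in> S \<Longrightarrow> F y \<le> F x"
  shows "pderiv_at j F x = 0"
proof -
  have "frechet_derivative F (at x) = (\<lambda>v. 0)"
    using assms(3,4)
    by (intro differential_zero_maxmin[OF assms(2,1)]) (auto simp: frechet_derivative_works)
  then show ?thesis by (simp add: pderiv_at_def)
qed

text \<open>Otherwise the derivative \<open>G\<close> along v, which is 0 at x, would be positive
  shortly after x, and by the mean value theorem F would exceed its maximum there.\<close>

lemma interior_max_imp_Hessian_le_0:
  fixes F :: "real^'n \<Rightarrow> real"
  assumes S: "open S" "x \<in> S" and sm: "smooth_on S F" and max: "\<And>y. y \<in> S \<Longrightarrow> F y \<le> F x"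
  shows "(\<Sum>i\<in>UNIV. \<Sum>j\<in>UNIV. v $ i * v $ j * pderiv_at i (pderiv_at j F) x) \<le> 0"
proof (rule ccontr)
  assume neg: "\<not> ?thesis"
  define G where "G = (\<lambda>y. \<Sum>j\<in>UNIV. v $ j * pderiv_at j F y)"
  have pd: "pderiv_at j F differentiable (at x)" for j
    using smooth_on_imp_differentiable[OF smooth_on_pderiv_at[OF sm] S(2)] .
  have dG: "G differentiable (at x)"
    unfolding G_def using pd by (auto intro!: differentiable_sum)
  have pG: "pderiv_at i G x = (\<Sum>j\<in>UNIV. v $ j * pderiv_at i (pderiv_at j F) x)" for i
    unfolding G_def using pd
    by (simp add: pderiv_at_sum pderiv_at_bounded_linear[OF bounded_linear_mult_right])
  have G0: "G x = 0"
    unfolding G_def using interior_max_imp_pderiv_eq_0[OF S smooth_on_imp_differentiable[OF sm S(2)] max] by simp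
  have "((\<lambda>t. G (x + t *\<^sub>R v)) has_real_derivative (\<Sum>i\<in>UNIV. v $ i * pderiv_at i G x)) (at 0)"
    using has_real_derivative_along_line[of G x 0 v] dG by simp
  moreover have "(\<Sum>i\<in>UNIV. v $ i * pderiv_at i G x) > 0"
    using neg by (simp add: pG sum_distrib_left mult.assoc)
  ultimately obtain d where d: "d > 0" "\<And>h. 0 < h \<Longrightarrow> h < d \<Longrightarrow> G x < G (x + h *\<^sub>R v)"
    using DERIV_pos_inc_right[of "\<lambda>t. G (x + t *\<^sub>R v)" _ 0] by auto
  have "open ((\<lambda>t. x + t *\<^sub>R v) -` S)"
    using S(1) by (intro open_vimage continuous_intros)
  moreover have "0 \<in> (\<lambda>t. x + t *\<^sub>R v) -` S" using S(2) by simp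
  ultimately obtain e where "e > 0" "ball 0 e \<subseteq> (\<lambda>t. x + t *\<^sub>R v) -` S"
    using openE by blast
  then have e: "e > 0" "\<And>t. \<bar>t\<bar> < e \<Longrightarrow> x + t *\<^sub>R v \<in> S"
    by (auto simp: subset_iff)
  define h where "h = min d e / 2"
  have h: "0 < h" "h < d" "h < e" using d(1) e(1) by (auto simp: h_def)
  have "\<exists>z. 0 < z \<and> z < h \<and> F (x + h *\<^sub>R v) - F (x + 0 *\<^sub>R v) = (h - 0) * G (x + z *\<^sub>R v)"
  proof (rule MVT2[OF h(1)])
    fix t assume "0 \<le> t" "t \<le> h"
    then have "x + t *\<^sub>R v \<in> S" using e(2)[of t] h by auto
    then show "((\<lambda>t. F (x + t *\<^sub>R v)) has_real_derivative G (x + t *\<^sub>R v)) (at t)"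
      unfolding G_def using has_real_derivative_along_line smooth_on_imp_differentiable[OF sm] by blast
  qed
  then obtain z where z: "0 < z" "z < h" "F (x + h *\<^sub>R v) - F x = h * G (x + z *\<^sub>R v)" by auto
  then have "F (x + h *\<^sub>R v) - F x > 0" using d(2)[of z] h G0 by simp
  moreover have "F (x + h *\<^sub>R v) \<le> F x" using max e(2)[of h] h by auto
  ultimately show False by simp
qed

text \<open>The gradient vanishes at the maximum, which removes \<open>b\<close> altogether; the
  rest is the trace of a semidefinite matrix against the Hessian.\<close>

lemma second_order_op_interior_max_le_0:
  fixes F :: "real^'n \<Rightarrow> real"
  assumes "open S" "x \<in> S" "smooth_on S F" "\<And>y. y \<in> S \<Longrightarrow> F y \<le> F x"
    and "transpose a = a" "\<And>v. 0 \<le> v \<bullet> (a *v v)"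
  shows "second_order_op a b F x \<le> 0"
proof -
  have "pderiv_at k F x = 0" for k
    using interior_max_imp_pderiv_eq_0[of S x F] assms smooth_on_imp_differentiable by blast
  moreover have "(\<Sum>i\<in>UNIV. \<Sum>j\<in>UNIV. a $ i $ j * pderiv_at i (pderiv_at j F) x) \<le> 0"
    using assms by (intro psd_nsd_trace_le_0 interior_max_imp_Hessian_le_0[of S]) auto
  ultimately show ?thesis by (simp add: second_order_op_def)
qed

lemma smooth_on_inner_self_diff: "open S \<Longrightarrow> smooth_on S (\<lambda>x::real^'n. (x - c) \<bullet> (x - c))"
  using smooth_on_bounded_bilinear[OF _ bounded_bilinear_inner, of S "\<lambda>x. x + - c" "\<lambda>x. x + - c"]
    smooth_on_add[OF _ smooth_on_bounded_linear[OF bounded_linear_ident] smooth_on_const, of S "-c"]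
  by simp

lemma pderiv_at_inner_self_diff:
  "pderiv_at i (\<lambda>x::real^'n. (x - c) \<bullet> (x - c)) x = 2 * (x - c) $ i"
proof -
  have "((\<lambda>x::real^'n. (x - c) \<bullet> (x - c)) has_derivative (\<lambda>v. (x - c) \<bullet> v + v \<bullet> (x - c))) (at x)"
    by (auto intro!: derivative_eq_intros)
  then have "pderiv_at i (\<lambda>x::real^'n. (x - c) \<bullet> (x - c)) x = (x - c) \<bullet> axis i 1 + axis i 1 \<bullet> (x - c)"
    by (rule pderiv_at_eqI)
  then show ?thesis by (simp add: inner_axis inner_axis')
qed

lemma continuous_on_second_order_op:
  assumes "smooth_on S F" "continuous_on S a" "continuous_on S b"
  shows "continuous_on S (\<lambda>x. second_order_op (a x) (b x) F x)"
proof -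
  have 1: "continuous_on S (pderiv_at i (pderiv_at j F))" for i j
    by (rule smooth_on_imp_continuous_on[OF smooth_on_pderiv_at[OF smooth_on_pderiv_at[OF assms(1)]]])
  have 2: "continuous_on S (pderiv_at j F)" for j
    by (rule smooth_on_imp_continuous_on[OF smooth_on_pderiv_at[OF assms(1)]])
  have 3: "continuous_on S (\<lambda>x. a x $ i $ j)" "continuous_on S (\<lambda>x. b x $ k)" for i j k
    by (rule continuous_on_component[OF continuous_on_component[OF assms(2)]],
        rule continuous_on_component[OF assms(3)])
  show ?thesis
    unfolding second_order_op_def
    by (intro continuous_on_add continuous_on_sum continuous_on_scaleR 1 2 3)
qed

text \<open>Hopf's argument: near \<open>p\<close> the function \<open>\<psi> = -s + K s\<^sup>2\<close>, where \<open>s\<close> vanishes on a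
  sphere tangent to the given one at \<open>p\<close> from inside, satisfies \<open>L \<psi> > 0\<close>, so that
  \<open>F + \<epsilon> \<psi>\<close> cannot have an interior maximum.\<close>

lemma no_max_on_sphere_of_strict_ball:
  fixes F :: "real^'n \<Rightarrow> real"
  assumes S: "open S" "cball z (dist z p) \<subseteq> S" and zp: "z \<noteq> p" and sm: "smooth_on S F"
    and max: "\<And>y. y \<in> S \<Longrightarrow> F y \<le> F p" and strict: "\<And>y. y \<in> ball z (dist z p) \<Longrightarrow> F y < F p"
    and cont: "continuous_on S a" "continuous_on S b"
    and sym: "\<And>x. x \<in> S \<Longrightarrow> transpose (a x) = a x"
    and pd: "\<And>x v. x \<in> S \<Longrightarrow> v \<noteq> 0 \<Longrightarrow> 0 < v \<bullet> (a x *v v)"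
    and L: "\<And>x. x \<in> S \<Longrightarrow> 0 \<le> second_order_op (a x) (b x) F x"
  shows False
proof -
  have pS: "p \<in> S" using S(2) by (auto simp: dist_commute)
  \<comment> \<open>With centre \<open>c\<close>, the midpoint of z and p, and radius |e|, the
    smaller sphere touches the given one at p from inside; its closed ball without p lies in the
    open ball where F is strictly smaller.\<close>
  define e where "e = (1/2) *\<^sub>R (p - z)"
  define c where "c = z + e"
  have pc: "p - c = e" by (simp add: c_def e_def vec_eq_iff field_simps)
  have e0: "e \<noteq> 0" using zp by (simp add: e_def)
  define s where "s = (\<lambda>x. (x - c) \<bullet> (x - c) + - (e \<bullet> e))"
  \<comment> \<open>As s p = 0, the product rule gives L \<psi> = - L s + 2 K |grad s|^2 at p; this
    K makes the value 1.\<close>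
  define K where "K = (second_order_op (a p) (b p) s p + 1) / (2 * gradient_product (a p) s s p)"
  define \<psi> where "\<psi> = (\<lambda>x. - s x + K * (s x * s x))"
  have sms: "smooth_on S s"
    unfolding s_def using smooth_on_add[OF S(1) smooth_on_inner_self_diff[OF S(1)] smooth_on_const] .
  have smm: "smooth_on S (\<lambda>x. - s x)"
    by (rule smooth_on_bounded_linear_compose[OF S(1) bounded_linear_minus[OF bounded_linear_ident] sms])
  have sm2: "smooth_on S (\<lambda>x. s x * s x)" by (rule smooth_on_mult[OF S(1) sms sms])
  have smK: "smooth_on S (\<lambda>x. K * (s x * s x))"
    by (rule smooth_on_bounded_linear_compose[OF S(1) bounded_linear_mult_right sm2])
  have sm\<psi>: "smooth_on S \<psi>" unfolding \<psi>_def by (rule smooth_on_add[OF S(1) smm smK])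
  have sp: "s p = 0" by (simp add: s_def pc)
  have "pderiv_at i s p = 2 * e $ i" for i
  proof -
    have "(\<lambda>x::real^'n. (x - c) \<bullet> (x - c)) differentiable at p"
      by (intro smooth_on_imp_differentiable[OF smooth_on_inner_self_diff[OF S(1)] pS])
    then show ?thesis
      unfolding s_def
      by (subst pderiv_at_add)
        (simp_all only: differentiable_const pderiv_at_const pderiv_at_inner_self_diff pc add_0_right)
  qed
  then have "gradient_product (a p) s s p = 4 * (e \<bullet> (a p *v e))"
    by (simp add: gradient_product_def inner_matrix_vector_mult_eq_sum sum_distrib_left mult_ac)
  then have gp: "gradient_product (a p) s s p > 0" using pd[OF pS e0] by simp
  have "second_order_op (a p) (b p) \<psi> p = - second_order_op (a p) (b p) s p
      + K * (2 * gradient_product (a p) s s p)"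
    unfolding \<psi>_def second_order_op_add[OF S(1) pS smm smK]
    using second_order_op_bounded_linear[OF S(1) pS sms bounded_linear_minus[OF bounded_linear_ident], of "a p" "b p"]
      second_order_op_bounded_linear[OF S(1) pS sm2 bounded_linear_mult_right, of "a p" "b p" K]
      second_order_op_mult[OF S(1) pS sms sms sym[OF pS], of "b p"] sp
    by simp
  then have L1: "second_order_op (a p) (b p) \<psi> p = 1" using gp by (simp add: K_def)
  have "continuous_on S (\<lambda>x. second_order_op (a x) (b x) \<psi> x)"
    by (rule continuous_on_second_order_op[OF sm\<psi> cont])
  from continuous_open_preimage[OF this S(1), of "{0<..}"]
  have "open (S \<inter> (\<lambda>x. second_order_op (a x) (b x) \<psi> x) -` {0<..})" (is "open ?U1") by simp
  moreover have "open (S \<inter> (\<lambda>x. K * s x) -` {..<1})" (is "open ?U2")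
    using smooth_on_imp_continuous_on[OF sms] S(1)
    by (intro continuous_open_preimage continuous_intros) auto
  ultimately have "open (?U1 \<inter> ?U2)" by (rule open_Int)
  moreover have "p \<in> ?U1 \<inter> ?U2" using pS L1 sp by simp
  \<comment> \<open>Near p two conditions hold: L \<psi> > 0, and K s < 1. The second makes \<psi>
    negative wherever s > 0.\<close>
  ultimately obtain d where d: "d > 0" "cball p d \<subseteq> ?U1 \<inter> ?U2"
    using open_contains_cball by blast
  have dS: "cball p d \<subseteq> S" using d(2) by auto
  \<comment> \<open>The parallelogram law with y - z = (y - c) + e and y - p = (y - c) - e gives |y
    - z| < 2 |e|, the radius of the given ball.\<close>
  have inside: "F y < F p" if "s y \<le> 0" "y \<noteq> p" for y
  proof -
    have "(norm (y - z))\<^sup>2 = (norm ((y - c) + e))\<^sup>2" by (simp add: c_def)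
    also have "\<dots> = 2 * ((y - c) \<bullet> (y - c)) + 2 * (e \<bullet> e) - (norm ((y - c) - e))\<^sup>2"
      by (simp add: power2_norm_eq_inner inner_simps inner_commute)
    also have "\<dots> < 4 * (e \<bullet> e)"
    proof -
      have eq: "(y - c) - e = y - p" by (simp flip: pc)
      have "(norm ((y - c) - e))\<^sup>2 > 0" unfolding eq using that(2) by simp
      then show ?thesis using that(1) unfolding s_def by linarith
    qed
    also have "\<dots> = (dist z p)\<^sup>2"
      by (simp add: e_def dist_norm power2_norm_eq_inner[symmetric] norm_minus_commute power_divide)
    finally have "norm (y - z) < dist z p" by (rule power2_less_imp_less) simp
    then show ?thesis by (intro strict) (simp add: dist_norm norm_minus_commute)
  qed
  \<comment> \<open>On this part of the boundary \<psi> may be positive, but it is compact and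
    avoids p, so F stays below F p by a fixed \<eta>.\<close>
  define C where "C = sphere p d \<inter> {y. s y \<le> 0}"
  have sc: "continuous_on UNIV s" unfolding s_def by (intro continuous_intros)
  have "closed {y. s y \<le> 0}"
    using sc by (intro closed_Collect_le) auto
  then have "compact C" unfolding C_def by (intro compact_Int_closed) auto
  moreover have Fc: "continuous_on C F"
    using continuous_on_subset[OF smooth_on_imp_continuous_on[OF sm]] dS
    by (metis C_def inf_le1 sphere_cball subset_trans)
  ultimately obtain \<eta> where \<eta>: "\<eta> > 0" "\<And>y. y \<in> C \<Longrightarrow> F y \<le> F p - \<eta>"
  proof (cases "C = {}")
    case True
    then show ?thesis using that[of 1] by auto
  next
    case False
    assume "compact C" "continuous_on C F"
    then obtain y0 where y0: "y0 \<in> C" "\<And>y. y \<in> C \<Longrightarrow> F y \<le> F y0"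
      using continuous_attains_sup False by metis
    moreover have "F y0 < F p" using y0(1) d(1) by (intro inside) (auto simp: C_def)
    ultimately show ?thesis using that[of "F p - F y0"] by auto
  qed
  have "continuous_on (cball p d) \<psi>"
    using continuous_on_subset[OF smooth_on_imp_continuous_on[OF sm\<psi>]] dS by blast
  then have "bounded (\<psi> ` cball p d)"
    by (intro compact_imp_bounded compact_continuous_image compact_cball)
  then obtain B where "\<forall>y\<in>\<psi> ` cball p d. norm y \<le> B"
    unfolding bounded_iff by blast
  then have B: "\<And>y. y \<in> cball p d \<Longrightarrow> \<bar>\<psi> y\<bar> \<le> B" by auto
  have B0: "B \<ge> 0" using B[of p] d(1) by auto
  \<comment> \<open>Small enough that \<epsilon> \<psi> cannot use up the gap \<eta>; B + 1 keeps
    the denominator positive when B = 0.\<close>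
  define \<epsilon> where "\<epsilon> = \<eta> / (2 * (B + 1))"
  have "\<eta> * B < \<eta> * (2 * (B + 1))" using \<eta>(1) B0 by (intro mult_strict_left_mono) auto
  then have \<epsilon>: "\<epsilon> > 0" "\<epsilon> * B < \<eta>" using \<eta>(1) B0 by (auto simp: \<epsilon>_def divide_simps)
  define G where "G = (\<lambda>x. F x + \<epsilon> * \<psi> x)"
  have sme: "smooth_on S (\<lambda>x. \<epsilon> * \<psi> x)"
    by (rule smooth_on_bounded_linear_compose[OF S(1) bounded_linear_mult_right sm\<psi>])
  have smG: "smooth_on S G" unfolding G_def by (rule smooth_on_add[OF S(1) sm sme])
  have Gp: "G p = F p" by (simp add: G_def \<psi>_def sp)
  obtain y where y: "y \<in> cball p d" "\<And>x. x \<in> cball p d \<Longrightarrow> G x \<le> G y"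
    using continuous_attains_sup[of "cball p d" G] d(1)
      continuous_on_subset[OF smooth_on_imp_continuous_on[OF smG] dS] by auto
  \<comment> \<open>Where s is at most 0, the gap \<eta> of F decides; elsewhere \<psi> < 0
    does.\<close>
  have bdry: "G x < F p" if x: "x \<in> sphere p d" for x
  proof (cases "s x \<le> 0")
    case True
    then have "F x \<le> F p - \<eta>" using \<eta>(2) x by (simp add: C_def)
    moreover have "\<epsilon> * \<psi> x \<le> \<epsilon> * B" using B[of x] x \<epsilon>(1) by (intro mult_left_mono) auto
    ultimately show ?thesis using \<epsilon>(2) by (simp add: G_def)
  next
    case False
    have xc: "x \<in> cball p d" using x by auto
    then have "K * s x < 1" using d(2) by auto
    then have "s x * (K * s x - 1) < 0" using False by (simp add: mult_less_0_iff)
    then have "\<psi> x < 0" by (simp add: \<psi>_def algebra_simps)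
    moreover have "F x \<le> F p" using max xc dS by blast
    moreover from calculation have "\<epsilon> * \<psi> x < 0" using \<epsilon>(1) by (simp add: mult_less_0_iff)
    ultimately show ?thesis unfolding G_def by linarith
  qed
  \<comment> \<open>The maximum of G over the closed ball is at least G p = F p, so it is attained
    in the interior, where L G > 0 is impossible.\<close>
  have "F p \<le> G y" using y(2)[of p] d(1) Gp by simp
  then have "y \<notin> sphere p d" using bdry[of y] by auto
  then have yb: "y \<in> ball p d" using y(1) by auto
  then have yS: "y \<in> S" using dS by auto
  have "second_order_op (a y) (b y) G y \<le> 0"
  proof (rule second_order_op_interior_max_le_0[of "ball p d"])
    show "smooth_on (ball p d) G" 
      using smooth_on_subset[OF smG order_trans[OF ball_subset_cball dS]] .
    show "0 \<le> v \<bullet> (a y *v v)" for v using pd[OF yS, of v] by (cases "v = 0") auto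
  qed (use yb y(2) sym yS in auto)
  moreover have "second_order_op (a y) (b y) G y
      = second_order_op (a y) (b y) F y + \<epsilon> * second_order_op (a y) (b y) \<psi> y"
    unfolding G_def second_order_op_add[OF S(1) yS sm sme]
    using second_order_op_bounded_linear[OF S(1) yS sm\<psi> bounded_linear_mult_right, of "a y" "b y" \<epsilon>] by simp
  moreover have "second_order_op (a y) (b y) \<psi> y > 0" using d(2) y(1) by auto
  then have "\<epsilon> * second_order_op (a y) (b y) \<psi> y > 0" using \<epsilon>(1) by simp
  ultimately show False using L[OF yS] by linarith
qed

text \<open>If F is not maximal at some q near p, the largest open ball about q that misses the
  maximum set has a point of that set on its boundary, against
  \<open>no_max_on_sphere_of_strict_ball\<close>.\<close>

lemma strong_maximum_principle_local:
  fixes F :: "real^'n \<Rightarrow> real"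
  assumes S: "open S" "p \<in> S" and sm: "smooth_on S F"
    and max: "\<And>y. y \<in> S \<Longrightarrow> F y \<le> F p"
    and cont: "continuous_on S a" "continuous_on S b"
    and sym: "\<And>x. x \<in> S \<Longrightarrow> transpose (a x) = a x"
    and pd: "\<And>x v. x \<in> S \<Longrightarrow> v \<noteq> 0 \<Longrightarrow> 0 < v \<bullet> (a x *v v)"
    and L: "\<And>x. x \<in> S \<Longrightarrow> 0 \<le> second_order_op (a x) (b x) F x"
  obtains r where "r > 0" "ball p r \<subseteq> S" "\<And>y. y \<in> ball p r \<Longrightarrow> F y = F p"
proof -
  obtain r where r: "r > 0" "cball p r \<subseteq> S" using S open_contains_cball by blast
  \<comment> \<open>Half the radius keeps the touching ball about q inside
    \<open>cball p r\<close>.\<close>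
  have "F q = F p" if q: "q \<in> ball p (r/2)" for q
  proof (rule ccontr)
    assume ne: "F q \<noteq> F p"
    define C where "C = {y \<in> cball p r. F y = F p}"
    have "closed C"
      unfolding C_def
      using continuous_closed_preimage_constant[OF continuous_on_subset[OF smooth_on_imp_continuous_on[OF sm] r(2)]]
      by simp
    moreover have "p \<in> C" using r(1) by (simp add: C_def)
    ultimately obtain p' where p': "p' \<in> C" "\<And>y. y \<in> C \<Longrightarrow> dist q p' \<le> dist q y"
      using distance_attains_inf[of C q] by blast
    have dq: "dist q p' < r/2"
      using p'(2)[OF \<open>p \<in> C\<close>] q by (simp add: dist_commute)
    have sub: "cball q (dist q p') \<subseteq> cball p r"
    proof
      fix y assume "y \<in> cball q (dist q p')"
      then have "dist q y < r/2" using dq by simp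
      moreover have "dist p q < r/2" using q by simp
      ultimately have "dist p y < r" using dist_triangle[of p y q] by linarith
      then show "y \<in> cball p r" by simp
    qed
    have Fp': "F p' = F p" using p'(1) by (simp add: C_def)
    show False
    proof (rule no_max_on_sphere_of_strict_ball[OF S(1) _ _ sm _ _ cont sym pd L])
      show "cball q (dist q p') \<subseteq> S" using sub r(2) by blast
      show "q \<noteq> p'" using ne Fp' by auto
      show "F y \<le> F p'" if "y \<in> S" for y using max[OF that] Fp' by simp
      show "F y < F p'" if y: "y \<in> ball q (dist q p')" for y
      proof -
        have "y \<in> cball p r" using subsetD[OF sub, of y] y by simp
        moreover have "y \<notin> C" using p'(2)[of y] y by auto
        ultimately have "y \<in> S" "F y \<noteq> F p" using r(2) by (auto simp: C_def)
        then show ?thesis using max[of y] Fp' by simp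
      qed
    qed
  qed
  moreover have "ball p (r/2) \<subseteq> S"
  proof
    fix y assume "y \<in> ball p (r/2)"
    then have "y \<in> cball p r" using r(1) by simp
    then show "y \<in> S" using r(2) by (rule subsetD[rotated])
  qed
  ultimately show thesis using that[OF half_gt_zero[OF r(1)]] by blast
qed

subsection \<open>The Laplace-Beltrami operator in a chart\<close>

lemma transpose_eq_self_component: "transpose a = a \<Longrightarrow> a $ i $ j = a $ j $ i"
  by (metis transpose_def vec_lambda_beta)

lemma
  assumes "invertible (G::real^'n^'n)"
  shows matrix_inv_right: "G ** matrix_inv G = mat 1"
    and matrix_inv_left: "matrix_inv G ** G = mat 1"
  using assms someI_ex[of "\<lambda>H. G ** H = mat 1 \<and> H ** G = mat 1"]
  unfolding invertible_def matrix_inv_def by blast+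

lemma posdef_imp_invertible:
  fixes G :: "real^'n^'n"
  assumes "\<And>v. v \<noteq> 0 \<Longrightarrow> 0 < v \<bullet> (G *v v)"
  shows "invertible G"
proof -
  have "v = 0" if "G *v v = 0" for v
    using assms[of v] that by (metis inner_zero_right less_irrefl)
  then show ?thesis
    using matrix_left_invertible_ker invertible_left_inverse by blast
qed

lemma transpose_matrix_inv:
  fixes G :: "real^'n^'n"
  assumes "invertible G" "transpose G = G"
  shows "transpose (matrix_inv G) = matrix_inv G"
proof -
  have "transpose (matrix_inv G) = transpose (matrix_inv G) ** (G ** matrix_inv G)"
    using assms(1) by (simp add: matrix_inv_right)
  also have "\<dots> = transpose (G ** matrix_inv G) ** matrix_inv G"
    by (simp add: matrix_mul_assoc matrix_transpose_mul assms(2))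
  finally show ?thesis using assms(1) by (simp add: matrix_inv_right transpose_mat)
qed

text \<open>For v = G w the form of the inverse at v equals the form of \<open>G\<close> at
  w.\<close>

lemma posdef_matrix_inv:
  fixes G :: "real^'n^'n"
  assumes pd: "\<And>v. v \<noteq> 0 \<Longrightarrow> 0 < v \<bullet> (G *v v)" and "v \<noteq> 0"
  shows "0 < v \<bullet> (matrix_inv G *v v)"
proof -
  have inv: "invertible G" by (rule posdef_imp_invertible[OF pd])
  define w where "w = matrix_inv G *v v"
  have v: "v = G *v w" using inv by (simp add: w_def matrix_vector_mul_assoc matrix_inv_right)
  then have "w \<noteq> 0" using \<open>v \<noteq> 0\<close> by auto
  then show ?thesis using pd[of w] by (simp add: w_def[symmetric] inner_commute flip: v)
qed

section \<open>Derivatives of the inverse matrix\<close>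

lemma differentiable_prod:
  fixes f :: "'i \<Rightarrow> 'a::real_normed_vector \<Rightarrow> real"
  assumes "finite I" "\<And>i. i \<in> I \<Longrightarrow> f i differentiable (at x)"
  shows "(\<lambda>y. \<Prod>i\<in>I. f i y) differentiable (at x)"
  using assms by induction (simp_all add: differentiable_mult)

lemma differentiable_det:
  fixes B :: "'a::real_normed_vector \<Rightarrow> real^'n^'n"
  assumes "\<And>i j. (\<lambda>y. B y $ i $ j) differentiable (at x)"
  shows "(\<lambda>y. det (B y)) differentiable (at x)"
  unfolding det_def
  by (intro differentiable_sum ballI finite_permutations differentiable_mult differentiable_const
      differentiable_prod assms finite)

text \<open>Cramer's rule: each entry of the inverse is a quotient of determinants, hence of
  polynomials in the entries of G. \<open>N\<close> has the l-th basis vector as its k-th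
  column.\<close>

lemma differentiable_matrix_inv:
  fixes G :: "'a::real_normed_vector \<Rightarrow> real^'n^'n"
  assumes "open S" "x \<in> S" "\<And>y. y \<in> S \<Longrightarrow> invertible (G y)"
    and diff: "\<And>i j. (\<lambda>y. G y $ i $ j) differentiable (at x)"
  shows "(\<lambda>y. matrix_inv (G y) $ k $ l) differentiable (at x)"
proof -
  define N where "N = (\<lambda>y. (\<chi> i j. if j = k then axis l 1 $ i else G y $ i $ j) :: real^'n^'n)"
  have eq: "matrix_inv (G y) $ k $ l = det (N y) / det (G y)" if "y \<in> S" for y
  proof -
    have inv: "invertible (G y)" using assms(3) that .
    then have "G y *v (matrix_inv (G y) *v axis l 1) = axis l 1"
      by (simp add: matrix_vector_mul_assoc matrix_inv_right)
    then have "matrix_inv (G y) *v axis l 1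
        = (\<chi> k. det (\<chi> i j. if j = k then axis l 1 $ i else G y $ i $ j) / det (G y))"
      using cramer inv invertible_det_nz by blast
    then have "(matrix_inv (G y) *v axis l 1) $ k = det (N y) / det (G y)" by (simp add: N_def)
    then show ?thesis by (simp add: matrix_vector_mult_basis column_def)
  qed
  have "(\<lambda>y. N y $ i $ j) differentiable (at x)" for i j
    using diff by (cases "j = k") (simp_all add: N_def)
  moreover have "det (G x) \<noteq> 0" using assms(2,3) invertible_det_nz by blast
  ultimately have "(\<lambda>y. det (N y) / det (G y)) differentiable (at x)"
    using diff by (intro differentiable_divide differentiable_det)
  then show ?thesis
    by (rule differentiable_cong_open[OF assms(1,2) eq, THEN iffD2, rotated])
qed

text \<open>Differentiating G^-1 G = 1 and multiplying by G^-1 on the right gives d(G^-1) = - G^-1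
  dG G^-1.\<close>

lemma pderiv_at_matrix_inv:
  fixes G :: "real^'n \<Rightarrow> real^'n^'n"
  assumes S: "open S" "x \<in> S" and inv: "\<And>y. y \<in> S \<Longrightarrow> invertible (G y)"
    and diff: "\<And>i j. (\<lambda>y. G y $ i $ j) differentiable (at x)"
  shows "pderiv_at i (\<lambda>y. matrix_inv (G y) $ k $ l) x
    = - (\<Sum>p\<in>UNIV. \<Sum>q\<in>UNIV. matrix_inv (G x) $ k $ p * pderiv_at i (\<lambda>y. G y $ p $ q) x * matrix_inv (G x) $ q $ l)"
proof -
  define a where "a = (\<lambda>y. matrix_inv (G y))"
  have da: "(\<lambda>y. a y $ k $ l) differentiable (at x)" for k l
    unfolding a_def by (rule differentiable_matrix_inv[OF S inv diff])
  have id: "(\<Sum>p\<in>UNIV. a y $ k $ p * G y $ p $ q) = (if k = q then 1 else 0)" if "y \<in> S" for y k q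
  proof -
    have "(a y ** G y) $ k $ q = mat 1 $ k $ q" using inv[OF that] by (simp add: a_def matrix_inv_left)
    then show ?thesis by (simp add: matrix_matrix_mult_def mat_def)
  qed
  have id': "(\<Sum>q\<in>UNIV. G x $ p $ q * a x $ q $ l) = (if p = l then 1 else 0)" for p l
  proof -
    have "(G x ** a x) $ p $ l = mat 1 $ p $ l" using inv[OF S(2)] by (simp add: a_def matrix_inv_right)
    then show ?thesis by (simp add: matrix_matrix_mult_def mat_def)
  qed
  have 0: "(\<Sum>p\<in>UNIV. pderiv_at i (\<lambda>y. a y $ k $ p) x * G x $ p $ q)
      = - (\<Sum>p\<in>UNIV. a x $ k $ p * pderiv_at i (\<lambda>y. G y $ p $ q) x)" for q
  proof -
    have "pderiv_at i (\<lambda>y. \<Sum>p\<in>UNIV. a y $ k $ p * G y $ p $ q) x = 0"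
      using pderiv_at_cong_open[OF S id] by (simp add: pderiv_at_const)
    moreover have "pderiv_at i (\<lambda>y. \<Sum>p\<in>UNIV. a y $ k $ p * G y $ p $ q) x
       = (\<Sum>p\<in>UNIV. a x $ k $ p * pderiv_at i (\<lambda>y. G y $ p $ q) x
            + pderiv_at i (\<lambda>y. a y $ k $ p) x * G x $ p $ q)"
      using da diff by (simp add: pderiv_at_sum pderiv_at_mult)
    ultimately show ?thesis by (simp add: sum.distrib)
  qed
  have "pderiv_at i (\<lambda>y. a y $ k $ l) x
      = (\<Sum>p\<in>UNIV. pderiv_at i (\<lambda>y. a y $ k $ p) x * (\<Sum>q\<in>UNIV. G x $ p $ q * a x $ q $ l))"
    unfolding id' by (simp add: if_distrib cong: if_cong)
  also have "\<dots> = (\<Sum>q\<in>UNIV. (\<Sum>p\<in>UNIV. pderiv_at i (\<lambda>y. a y $ k $ p) x * G x $ p $ q) * a x $ q $ l)"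
    unfolding sum_distrib_left sum_distrib_right by (subst sum.swap) (simp add: mult.assoc)
  also have "\<dots> = - (\<Sum>q\<in>UNIV. \<Sum>p\<in>UNIV. a x $ k $ p * pderiv_at i (\<lambda>y. G y $ p $ q) x * a x $ q $ l)"
    unfolding 0 by (simp add: sum_negf sum_distrib_right)
  finally show ?thesis unfolding a_def by (subst sum.swap)
qed

text \<open>The index computation that identifies the first order part of the Laplace-Beltrami operator
  as \<open>- g\<^sup>p\<^sup>q \<Gamma>\<^sup>j\<^sub>p\<^sub>q\<close>; here \<open>D l i j\<close> stands for
  \<open>\<partial>\<^sub>l g\<^sub>i\<^sub>j\<close> and \<open>a\<close> for the inverse metric.\<close>

lemma contracted_christoffel_identity:
  fixes a :: "'n::finite \<Rightarrow> 'n \<Rightarrow> real" and D :: "'n \<Rightarrow> 'n \<Rightarrow> 'n \<Rightarrow> real"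
  assumes a: "\<And>i j. a i j = a j i" and D: "\<And>l i j. D l i j = D l j i"
  defines "\<Gamma> \<equiv> \<lambda>k i j. 1/2 * (\<Sum>l\<in>UNIV. a k l * (D i j l + D j i l - D l i j))"
  shows "(\<Sum>i\<in>UNIV. - (\<Sum>p\<in>UNIV. \<Sum>q\<in>UNIV. a i p * D i p q * a q j)) + (\<Sum>i\<in>UNIV. \<Sum>k\<in>UNIV. \<Gamma> i i k * a k j)
    = - (\<Sum>p\<in>UNIV. \<Sum>q\<in>UNIV. a p q * \<Gamma> j p q)"
proof -
  \<comment> \<open>X and Y are the only two contractions of the metric derivatives that occur; both
    sides of the claim equal (1/2) a Y - a X.\<close>
  define X where "X = (\<lambda>l. \<Sum>p\<in>UNIV. \<Sum>q\<in>UNIV. a p q * D p q l)"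
  define Y where "Y = (\<lambda>l. \<Sum>p\<in>UNIV. \<Sum>q\<in>UNIV. a p q * D l p q)"
  have X': "(\<Sum>p\<in>UNIV. \<Sum>q\<in>UNIV. a p q * D q p l) = X l" for l
    unfolding X_def by (subst sum.swap) (simp add: a)
  have 1: "(\<Sum>i\<in>UNIV. - (\<Sum>p\<in>UNIV. \<Sum>q\<in>UNIV. a i p * D i p q * a q j)) = - (\<Sum>q\<in>UNIV. a j q * X q)"
  proof -
    have "(\<Sum>i\<in>UNIV. \<Sum>p\<in>UNIV. \<Sum>q\<in>UNIV. a i p * D i p q * a q j)
        = (\<Sum>i\<in>UNIV. \<Sum>q\<in>UNIV. \<Sum>p\<in>UNIV. a i p * D i p q * a q j)"
      by (intro sum.cong refl sum.swap)
    also have "\<dots> = (\<Sum>q\<in>UNIV. \<Sum>i\<in>UNIV. \<Sum>p\<in>UNIV. a i p * D i p q * a q j)"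
      by (rule sum.swap)
    also have "\<dots> = (\<Sum>q\<in>UNIV. a j q * X q)"
      unfolding X_def sum_distrib_left by (intro sum.cong refl) (simp add: a[of j] mult_ac)
    finally show ?thesis by (simp add: sum_negf)
  qed
  \<comment> \<open>In the trace the first and third derivative terms cancel by symmetry of a and
    D.\<close>
  have 2: "(\<Sum>i\<in>UNIV. \<Gamma> i i k) = 1/2 * Y k" for k
  proof -
    have "(\<Sum>i\<in>UNIV. \<Sum>l\<in>UNIV. a i l * D i k l) = (\<Sum>i\<in>UNIV. \<Sum>l\<in>UNIV. a i l * D l i k)"
      by (subst sum.swap) (intro sum.cong refl, simp add: a D)
    then show ?thesis
      unfolding \<Gamma>_def Y_def sum_distrib_left[symmetric]
      by (simp add: distrib_left right_diff_distrib sum.distrib sum_subtractf)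
  qed
  have "(\<Sum>i\<in>UNIV. \<Sum>k\<in>UNIV. \<Gamma> i i k * a k j) = (\<Sum>k\<in>UNIV. (\<Sum>i\<in>UNIV. \<Gamma> i i k) * a k j)"
    unfolding sum_distrib_right by (rule sum.swap)
  then have 3: "(\<Sum>i\<in>UNIV. \<Sum>k\<in>UNIV. \<Gamma> i i k * a k j) = 1/2 * (\<Sum>k\<in>UNIV. a j k * Y k)"
    unfolding 2 sum_distrib_left by (simp add: a[of j] mult_ac)
  have "(\<Sum>p\<in>UNIV. \<Sum>q\<in>UNIV. a p q * \<Gamma> j p q)
      = (\<Sum>p\<in>UNIV. \<Sum>q\<in>UNIV. \<Sum>l\<in>UNIV. 1/2 * (a j l * (a p q * (D p q l + D q p l - D l p q))))"
    unfolding \<Gamma>_def sum_distrib_left by (intro sum.cong refl) simp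
  also have "\<dots> = (\<Sum>p\<in>UNIV. \<Sum>l\<in>UNIV. \<Sum>q\<in>UNIV. 1/2 * (a j l * (a p q * (D p q l + D q p l - D l p q))))"
    by (intro sum.cong refl sum.swap)
  also have "\<dots> = (\<Sum>l\<in>UNIV. \<Sum>p\<in>UNIV. \<Sum>q\<in>UNIV. 1/2 * (a j l * (a p q * (D p q l + D q p l - D l p q))))"
    by (rule sum.swap)
  also have "\<dots> = (\<Sum>l\<in>UNIV. 1/2 * (a j l * (X l + X l - Y l)))"
  proof (rule sum.cong[OF refl])
    fix l
    have "(\<Sum>p\<in>UNIV. \<Sum>q\<in>UNIV. a p q * (D p q l + D q p l - D l p q))
        = X l + (\<Sum>p\<in>UNIV. \<Sum>q\<in>UNIV. a p q * D q p l) - Y l"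
      by (simp add: X_def Y_def distrib_left right_diff_distrib sum.distrib sum_subtractf)
    then have "X l + X l - Y l = (\<Sum>p\<in>UNIV. \<Sum>q\<in>UNIV. a p q * (D p q l + D q p l - D l p q))"
      unfolding X' by simp
    then show "(\<Sum>p\<in>UNIV. \<Sum>q\<in>UNIV. 1/2 * (a j l * (a p q * (D p q l + D q p l - D l p q))))
        = 1/2 * (a j l * (X l + X l - Y l))"
      by (simp only: sum_distrib_left[symmetric])
  qed
  also have "\<dots> = (\<Sum>l\<in>UNIV. a j l * X l) - 1/2 * (\<Sum>l\<in>UNIV. a j l * Y l)"
    by (simp add: sum_distrib_left sum_subtractf[symmetric] algebra_simps)
  finally show ?thesis unfolding 1 3 by simp
qed

text \<open>The first order coefficients of tau. Written through contracted Christoffel symbols they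
  are also those of the tension field of a circle map, so one operator describes both.\<close>

definition drift :: "('a, 'n::finite) metric \<Rightarrow> ('a, 'n) chart \<Rightarrow> real^'n \<Rightarrow> real^'n" where
  "drift g c x = (\<chi> k. - (\<Sum>i\<in>UNIV. \<Sum>j\<in>UNIV. inv_metric g c x $ i $ j * christoffel g c k i j x))"

section \<open>The coefficients of the Laplace-Beltrami operator\<close>

context riemannian_manifold
begin

lemma metric_invertible: "c \<in> A \<Longrightarrow> x \<in> chart_img c \<Longrightarrow> invertible (g c x)"
  using posdef_imp_invertible metric_pos by blast

lemma inv_metric_sym: "c \<in> A \<Longrightarrow> x \<in> chart_img c \<Longrightarrow> transpose (inv_metric g c x) = inv_metric g c x"
  unfolding inv_metric_def by (intro transpose_matrix_inv metric_invertible metric_sym)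

lemma inv_metric_pos:
  "c \<in> A \<Longrightarrow> x \<in> chart_img c \<Longrightarrow> v \<noteq> 0 \<Longrightarrow> 0 < v \<bullet> (inv_metric g c x *v v)"
  unfolding inv_metric_def using metric_pos by (intro posdef_matrix_inv)

lemma smooth_on_metric_component:
  assumes "c \<in> A"
  shows "smooth_on (chart_img c) (\<lambda>y. g c y $ i $ j)"
  using smooth_on_bounded_linear_compose[OF img_open[OF assms]
      bounded_linear_compose[OF bounded_linear_vec_nth bounded_linear_vec_nth] metric_smooth[OF assms]] .

lemma metric_component_differentiable:
  "c \<in> A \<Longrightarrow> x \<in> chart_img c \<Longrightarrow> (\<lambda>y. g c y $ i $ j) differentiable (at x)"
  using smooth_on_metric_component smooth_on_imp_differentiable by blast

text \<open>One derivative is enough: the divergence differentiates the gradient once, and the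
  maximum principle asks for continuous coefficients.\<close>

lemma inv_metric_differentiable:
  assumes "c \<in> A" "x \<in> chart_img c"
  shows "(\<lambda>y. inv_metric g c y $ k $ l) differentiable (at x)"
  unfolding inv_metric_def
  by (rule differentiable_matrix_inv[OF img_open[OF assms(1)] assms(2) metric_invertible[OF assms(1)]
        metric_component_differentiable[OF assms]])

lemma continuous_on_inv_metric_component:
  "c \<in> A \<Longrightarrow> continuous_on (chart_img c) (\<lambda>y. inv_metric g c y $ k $ l)"
  by (intro continuous_at_imp_continuous_on ballI differentiable_imp_continuous_within
      inv_metric_differentiable)

lemma continuous_on_inv_metric:
  assumes "c \<in> A"
  shows "continuous_on (chart_img c) (inv_metric g c)"
proof -
  have "continuous_on (chart_img c) (\<lambda>y. \<chi> k l. inv_metric g c y $ k $ l)"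
    by (intro continuous_on_vec_lambda continuous_on_inv_metric_component assms)
  then show ?thesis by simp
qed

lemma continuous_on_drift:
  assumes "c \<in> A"
  shows "continuous_on (chart_img c) (drift g c)"
proof -
  have "continuous_on (chart_img c) (pderiv_at k (\<lambda>y. g c y $ i $ j))" for k i j
    using smooth_on_imp_continuous_on[OF smooth_on_pderiv_at[OF smooth_on_metric_component[OF assms]]] .
  then show ?thesis
    unfolding drift_def christoffel_def
    by (intro continuous_on_vec_lambda continuous_on_minus continuous_on_sum continuous_on_mult
        continuous_on_add continuous_on_diff continuous_on_const
        continuous_on_inv_metric_component[OF assms])
qed

text \<open>The product rule for the gradient components yields the second order part and terms with
  derivatives of the inverse metric. Together with the Christoffel terms of the divergence, the
  latter form the drift by \<open>contracted_christoffel_identity\<close>.\<close>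

lemma laplace_beltrami_eq_second_order_op:
  assumes c: "c \<in> A" and x: "x \<in> chart_img c" and sm: "smooth_on (chart_img c) (\<phi> \<circ> chart_inv c)"
  shows "laplace_beltrami g c \<phi> x
    = second_order_op (inv_metric g c x) (drift g c x) (\<phi> \<circ> chart_inv c) x"
proof -
  define u where "u = \<phi> \<circ> chart_inv c"
  define a where "a = (\<lambda>i j. inv_metric g c x $ i $ j)"
  define D where "D = (\<lambda>l i j. pderiv_at l (\<lambda>y. g c y $ i $ j) x)"
  define da where "da = (\<lambda>l i j. pderiv_at l (\<lambda>y. inv_metric g c y $ i $ j) x)"
  note S = img_open[OF c] x
  have a: "inv_metric g c x $ i $ j = a i j" for i j by (simp add: a_def)
  have asym: "a i j = a j i" for i j
    unfolding a_def by (rule transpose_eq_self_component[OF inv_metric_sym[OF c x]])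
  have Dsym: "D l i j = D l j i" for l i j
    unfolding D_def
  proof (rule pderiv_at_cong_open[OF S])
    fix y assume "y \<in> chart_img c"
    then show "g c y $ i $ j = g c y $ j $ i"
      by (intro transpose_eq_self_component metric_sym[OF c])
  qed
  have \<Gamma>: "christoffel g c k i j x = 1/2 * (\<Sum>l\<in>UNIV. a k l * (D i j l + D j i l - D l i j))" for k i j
    by (simp add: christoffel_def a_def D_def)
  have da: "da i k l = - (\<Sum>p\<in>UNIV. \<Sum>q\<in>UNIV. a k p * D i p q * a q l)" for i k l
    unfolding da_def a_def D_def inv_metric_def
    by (rule pderiv_at_matrix_inv[where G = "g c", OF S metric_invertible[OF c] metric_component_differentiable[OF c x]])
  have drift: "(\<Sum>i\<in>UNIV. da i i j) + (\<Sum>i\<in>UNIV. \<Sum>k\<in>UNIV. christoffel g c i i k x * a k j) = drift g c x $ j"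
    for j
    using contracted_christoffel_identity[of a D j, OF asym Dsym]
    by (simp add: drift_def da \<Gamma> a)
  have du: "pderiv_at j u differentiable (at x)" for j
    using smooth_on_imp_differentiable[OF smooth_on_pderiv_at[OF sm] x] by (simp add: u_def)
  have dA: "(\<lambda>y. complex_of_real (inv_metric g c y $ i $ j)) differentiable (at x)" for i j
    by (rule differentiable_compose[OF bounded_linear_imp_differentiable[OF bounded_linear_of_real]
          inv_metric_differentiable[OF c x]])
  have dg: "pderiv_at i (\<lambda>y. gradient g c \<phi> y $ i) x
      = (\<Sum>j\<in>UNIV. of_real (a i j) * pderiv_at i (pderiv_at j u) x + of_real (da i i j) * pderiv_at j u x)" for i
    using du dA inv_metric_differentiable[OF c x]
    by (simp add: gradient_def u_def[symmetric] pderiv_at_sum pderiv_at_mult a_def da_def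
        pderiv_at_bounded_linear[OF bounded_linear_of_real])
  have "laplace_beltrami g c \<phi> x
      = (\<Sum>i\<in>UNIV. \<Sum>j\<in>UNIV. of_real (a i j) * pderiv_at i (pderiv_at j u) x)
        + ((\<Sum>i\<in>UNIV. \<Sum>j\<in>UNIV. of_real (da i i j) * pderiv_at j u x)
        + (\<Sum>i\<in>UNIV. \<Sum>k\<in>UNIV. of_real (christoffel g c i i k x) * (\<Sum>j\<in>UNIV. of_real (a k j) * pderiv_at j u x)))"
    unfolding laplace_beltrami_def divergence_def dg
    by (simp add: sum.distrib gradient_def u_def[symmetric] a_def)
  also have "(\<Sum>i\<in>UNIV. \<Sum>j\<in>UNIV. of_real (da i i j) * pderiv_at j u x)
      = (\<Sum>j\<in>UNIV. of_real (\<Sum>i\<in>UNIV. da i i j) * pderiv_at j u x)"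
    by (subst sum.swap) (simp add: sum_distrib_right)
  also have "(\<Sum>i\<in>UNIV. \<Sum>k\<in>UNIV. of_real (christoffel g c i i k x) * (\<Sum>j\<in>UNIV. of_real (a k j) * pderiv_at j u x))
      = (\<Sum>j\<in>UNIV. of_real (\<Sum>i\<in>UNIV. \<Sum>k\<in>UNIV. christoffel g c i i k x * a k j) * pderiv_at j u x)"
  proof -
    have "(\<Sum>i\<in>UNIV. \<Sum>k\<in>UNIV. of_real (christoffel g c i i k x) * (\<Sum>j\<in>UNIV. of_real (a k j) * pderiv_at j u x))
       = (\<Sum>i\<in>UNIV. \<Sum>k\<in>UNIV. \<Sum>j\<in>UNIV. of_real (christoffel g c i i k x * a k j) * pderiv_at j u x)"
      by (simp add: sum_distrib_left mult.assoc)
    also have "\<dots> = (\<Sum>i\<in>UNIV. \<Sum>j\<in>UNIV. \<Sum>k\<in>UNIV. of_real (christoffel g c i i k x * a k j) * pderiv_at j u x)"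
      by (intro sum.cong refl sum.swap)
    also have "\<dots> = (\<Sum>j\<in>UNIV. \<Sum>i\<in>UNIV. \<Sum>k\<in>UNIV. of_real (christoffel g c i i k x * a k j) * pderiv_at j u x)"
      by (rule sum.swap)
    finally show ?thesis by (simp add: sum_distrib_right)
  qed
  finally show ?thesis
    by (simp add: second_order_op_def u_def[symmetric] drift[symmetric] a
        scaleR_conv_of_real sum.distrib distrib_right)
qed

text \<open>Each gradient carries one inverse metric, and the metric pairing them cancels one of the
  two.\<close>

lemma conformality_eq_gradient_product:
  assumes c: "c \<in> A" and x: "x \<in> chart_img c"
  shows "conformality g c \<phi> \<psi> x
    = gradient_product (inv_metric g c x) (\<phi> \<circ> chart_inv c) (\<psi> \<circ> chart_inv c) x"
proof -
  define a where "a = (\<lambda>i j. complex_of_real (inv_metric g c x $ i $ j))"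
  define G where "G = (\<lambda>i j. complex_of_real (g c x $ i $ j))"
  define u where "u = (\<lambda>i. pderiv_at i (\<phi> \<circ> chart_inv c) x)"
  define w where "w = (\<lambda>i. pderiv_at i (\<psi> \<circ> chart_inv c) x)"
  have id: "(\<Sum>j\<in>UNIV. G i j * (\<Sum>l\<in>UNIV. a j l * w l)) = w i" for i
  proof -
    have "(\<Sum>j\<in>UNIV. g c x $ i $ j * inv_metric g c x $ j $ l) = (if i = l then 1 else 0)" for l
    proof -
      have "(g c x ** inv_metric g c x) $ i $ l = mat 1 $ i $ l"
        using metric_invertible[OF c x] by (simp add: inv_metric_def matrix_inv_right)
      then show ?thesis by (simp add: matrix_matrix_mult_def mat_def)
    qed
    then have *: "(\<Sum>j\<in>UNIV. G i j * a j l) = (if i = l then 1 else 0)" for l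
      unfolding G_def a_def of_real_mult[symmetric] of_real_sum[symmetric] by simp
    have "(\<Sum>j\<in>UNIV. G i j * (\<Sum>l\<in>UNIV. a j l * w l)) = (\<Sum>l\<in>UNIV. (\<Sum>j\<in>UNIV. G i j * a j l) * w l)"
      unfolding sum_distrib_left sum_distrib_right by (subst sum.swap) (simp add: mult.assoc)
    then show ?thesis unfolding * by (simp add: if_distrib if_distribR cong: if_cong)
  qed
  define V where "V = (\<lambda>i. \<Sum>k\<in>UNIV. a i k * u k)"
  define W where "W = (\<lambda>i. \<Sum>k\<in>UNIV. a i k * w k)"
  have "conformality g c \<phi> \<psi> x = (\<Sum>i\<in>UNIV. \<Sum>j\<in>UNIV. G i j * V i * W j)"
    by (simp add: conformality_def metric_C_def gradient_def a_def G_def u_def w_def V_def W_def)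
  also have "\<dots> = (\<Sum>i\<in>UNIV. V i * (\<Sum>j\<in>UNIV. G i j * W j))"
    by (simp add: sum_distrib_left mult_ac)
  also have "\<dots> = (\<Sum>i\<in>UNIV. \<Sum>k\<in>UNIV. a k i * (u k * w i))"
  proof -
    have "a i k = a k i" for i k
      unfolding a_def using transpose_eq_self_component[OF inv_metric_sym[OF c x]] by simp
    then show ?thesis unfolding W_def id unfolding V_def sum_distrib_right by (intro sum.cong refl) (simp add: mult_ac)
  qed
  also have "\<dots> = (\<Sum>k\<in>UNIV. \<Sum>i\<in>UNIV. a k i * (u k * w i))" by (rule sum.swap)
  finally show ?thesis
    by (simp add: gradient_product_def a_def u_def w_def scaleR_conv_of_real)
qed

end

section \<open>Tension fields of maps to the circle\<close>

lemma christoffel_circle_metric: "christoffel (circle_metric r) d k i j x = 0"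
  by (simp add: christoffel_def circle_metric_def pderiv_at_const)

text \<open>With the target symbols zero, only the Hessian and the domain symbols remain, and
  contracting the latter produces the drift; the scale r of the circle drops out.\<close>

lemma tension_field_circle_eq_second_order_op:
  "tension_field g (circle_metric r) c d F x $ s
    = second_order_op (inv_metric g c x) (drift g c x) (\<lambda>y. local_rep c d F y $ s) x"
proof -
  define f where "f = (\<lambda>y. local_rep c d F y $ s)"
  define a where "a = (\<lambda>i j. inv_metric g c x $ i $ j)"
  define C where "C = (\<lambda>k i j. christoffel g c k i j x)"
  have "tension_field g (circle_metric r) c d F x $ s
    = (\<Sum>i\<in>UNIV. \<Sum>j\<in>UNIV. a i j * pderiv_at i (pderiv_at j f) x)
      - (\<Sum>i\<in>UNIV. \<Sum>j\<in>UNIV. \<Sum>k\<in>UNIV. a i j * C k i j * pderiv_at k f x)"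
    by (simp add: tension_field_def second_fund_form_def christoffel_circle_metric f_def[symmetric]
        a_def C_def right_diff_distrib sum_subtractf sum_distrib_left mult.assoc)
  also have "(\<Sum>i\<in>UNIV. \<Sum>j\<in>UNIV. \<Sum>k\<in>UNIV. a i j * C k i j * pderiv_at k f x)
      = (\<Sum>i\<in>UNIV. \<Sum>k\<in>UNIV. \<Sum>j\<in>UNIV. a i j * C k i j * pderiv_at k f x)"
    by (intro sum.cong refl sum.swap)
  also have "\<dots> = (\<Sum>k\<in>UNIV. \<Sum>i\<in>UNIV. \<Sum>j\<in>UNIV. a i j * C k i j * pderiv_at k f x)"
    by (rule sum.swap)
  finally show ?thesis
    by (simp add: second_order_op_def f_def[symmetric] drift_def a_def C_def sum_distrib_right sum_negf)
qed

subsection \<open>Angle functions\<close>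

lemma cis_eq_1_imp: "cis t = 1 \<Longrightarrow> \<exists>k::int. t = of_int k * (2 * pi)"
  using exp_eq_1[of "\<i> * complex_of_real t"] by (auto simp: cis_conv_exp mult_ac)

lemma cis_inj_on_open_interval: "inj_on cis {a<..<a + 2 * pi}"
proof (rule inj_onI)
  fix s t assume st: "s \<in> {a<..<a + 2 * pi}" "t \<in> {a<..<a + 2 * pi}" "cis s = cis t"
  then have "cis (s - t) = 1" by (simp flip: cis_divide)
  then obtain k :: int where k: "s - t = of_int k * (2 * pi)"
    using cis_eq_1_imp by blast
  have "\<bar>of_int k * (2 * pi)\<bar> < 1 * (2 * pi)" using st k by auto
  then have "\<bar>of_int k :: real\<bar> < 1" by (simp add: abs_mult)
  then have "k = 0" by linarith
  then show "s = t" using k by simp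
qed

lemma cis_image_open_interval: "cis ` {a<..<a + 2 * pi} = sphere 0 1 - {cis a}"
proof (intro equalityI subsetI)
  fix z assume "z \<in> cis ` {a<..<a + 2 * pi}"
  then obtain t where t: "t \<in> {a<..<a + 2 * pi}" "z = cis t" by blast
  have "cis t \<noteq> cis a"
  proof
    assume "cis t = cis a"
    then have "cis (t - a) = 1" by (simp flip: cis_divide)
    then obtain k :: int where k: "t - a = of_int k * (2 * pi)"
      using cis_eq_1_imp by blast
    have "0 < of_int k * (2 * pi)" "of_int k * (2 * pi) < 1 * (2 * pi)"
      unfolding k[symmetric] using t(1) by auto
    then have "0 < k" "(of_int k::real) < 1" by (simp_all add: zero_less_mult_iff)
    then show False by simp
  qed
  then show "z \<in> sphere 0 1 - {cis a}" using t by simp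
next
  fix z assume z: "z \<in> sphere 0 1 - {cis a}"
  \<comment> \<open>The factor - cis (- a) rotates the omitted point cis a to -1, where
    \<open>Arg\<close> has its exceptional value pi.\<close>
  define t where "t = Arg (- z * cis (- a))"
  have "norm (- z * cis (- a)) = 1" using z by (simp add: norm_mult)
  moreover from this have "- z * cis (- a) \<noteq> 0" by (metis norm_zero zero_neq_one)
  ultimately have eq: "cis t = - z * cis (- a)" unfolding t_def using cis_Arg by (simp add: sgn_div_norm)
  have "z = z * (cis (- a) * cis a)" by (simp add: cis_mult)
  also have "\<dots> = - cis t * cis a" using eq by (simp add: mult.assoc)
  also have "\<dots> = cis (t + pi + a)" by (simp add: cis_mult[symmetric])
  finally have zt: "z = cis (t + pi + a)" .
  have "t > - pi" "t \<le> pi" using Arg_bounded[of "- z * cis (- a)"] by (auto simp: t_def)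
  moreover have "t \<noteq> pi"
  proof
    assume "t = pi"
    then have "z = cis a" using zt by (simp add: cis_mult[symmetric])
    then show False using z by simp
  qed
  ultimately have "t + pi + a \<in> {a<..<a + 2 * pi}" by auto
  then show "z \<in> cis ` {a<..<a + 2 * pi}" using zt by blast
qed

lemma cis_inv_into: "z \<in> cis ` {a<..<a + 2 * pi} \<Longrightarrow> cis (inv_into {a<..<a + 2 * pi} cis z) = z"
  by (rule f_inv_into_f)

text \<open>The rotation by - cis (- a) moves the omitted point onto the branch cut of
  \<open>Ln\<close>. So the set-theoretic inverse of \<open>cis\<close> becomes a branch of the
  logarithm and inherits continuity and derivatives from it.\<close>

lemma
  assumes "z \<in> cis ` {a<..<a + 2 * pi}"
  shows inv_into_cis_eq_Ln: "inv_into {a<..<a + 2 * pi} cis z = a + pi + Im (Ln (- cis (- a) * z))"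
    and rotated_not_nonpos_Real: "- cis (- a) * z \<notin> \<real>\<^sub>\<le>\<^sub>0"
proof -
  obtain t where t: "t \<in> {a<..<a + 2 * pi}" "z = cis t" using assms by blast
  have "cis (t - a - pi) = cis (- a) * cis t * cis (- pi)" by (simp add: cis_mult algebra_simps)
  moreover have "cis (- pi) = - 1" by (simp add: complex_eq_iff)
  ultimately have eq: "- cis (- a) * z = cis (t - a - pi)" using t(2) by simp
  have Ln: "Ln (cis (t - a - pi)) = \<i> * of_real (t - a - pi)"
    unfolding cis_conv_exp by (rule Ln_exp) (use t(1) in auto)
  show "inv_into {a<..<a + 2 * pi} cis z = a + pi + Im (Ln (- cis (- a) * z))"
    unfolding eq Ln using t inv_into_f_f[OF cis_inj_on_open_interval t(1)] by simp
  show "- cis (- a) * z \<notin> \<real>\<^sub>\<le>\<^sub>0"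
  proof
    assume "- cis (- a) * z \<in> \<real>\<^sub>\<le>\<^sub>0"
    then obtain r where r: "cis (t - a - pi) = of_real r" "r \<le> 0"
      unfolding eq by (auto elim: nonpos_Reals_cases)
    then have "\<bar>r\<bar> = 1" by (metis norm_cis norm_of_real)
    then have "cis (t - a - pi) = - 1" using r by simp
    then have "Im (Ln (cis (t - a - pi))) = pi" by simp
    then show False unfolding Ln using t(1) by simp
  qed
qed

text \<open>The differential of the angle is Im (du / u), and 1 / u is the conjugate of u on the
  unit circle.\<close>

lemma angle_has_derivative:
  fixes u :: "'a::real_normed_vector \<Rightarrow> complex"
  assumes "open T" "x \<in> T" and u: "\<And>y. y \<in> T \<Longrightarrow> u y \<in> cis ` {a<..<a + 2 * pi}"
    and du: "(u has_derivative u') (at x)"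
  shows "((\<lambda>y. inv_into {a<..<a + 2 * pi} cis (u y)) has_derivative (\<lambda>v. Im (cnj (u x) * u' v))) (at x)"
proof -
  define w where "w = - cis (- a)"
  have w0: "w \<noteq> 0" by (simp add: w_def)
  have "norm (u x) = 1" using u[OF assms(2)] by auto
  then have inv: "inverse (u x) = cnj (u x)"
    by (simp add: inverse_complex_def cnj_def complex_norm_square complex_eq_iff cmod_power2[symmetric]
        flip: cmod_power2)
  have "((\<lambda>y. w * u y) has_derivative (\<lambda>v. w * u' v)) (at x)"
    by (rule has_derivative_mult_right[OF du])
  moreover have "(Ln has_derivative (*) (inverse (w * u x))) (at (w * u x))"
    using has_field_derivative_Ln[OF rotated_not_nonpos_Real[OF u[OF assms(2)], folded w_def]]
    by (simp add: has_field_derivative_def)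
  ultimately have "((\<lambda>y. Ln (w * u y)) has_derivative (\<lambda>v. inverse (w * u x) * (w * u' v))) (at x)"
    using diff_chain_at by (fastforce simp: o_def)
  then have "((\<lambda>y. a + pi + Im (Ln (w * u y))) has_derivative (\<lambda>v. Im (inverse (w * u x) * (w * u' v)))) (at x)"
    by (auto intro!: derivative_eq_intros bounded_linear.has_derivative[OF bounded_linear_Im])
  moreover have "inverse (w * u x) * (w * u' v) = cnj (u x) * u' v" for v
    using w0 by (simp add: inv[symmetric])
  ultimately have "((\<lambda>y. a + pi + Im (Ln (w * u y))) has_derivative (\<lambda>v. Im (cnj (u x) * u' v))) (at x)"
    by (simp only:)
  moreover have "a + pi + Im (Ln (w * u y)) = inv_into {a<..<a + 2 * pi} cis (u y)" if "y \<in> T" for y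
    unfolding w_def by (rule inv_into_cis_eq_Ln[OF u[OF that], symmetric])
  ultimately show ?thesis
    by (rule has_derivative_transform_within_open[OF _ assms(1,2)])
qed

text \<open>The derivative Im (cnj u * du) arises from u and du by linear and bilinear maps, so
  \<open>smooth_onI\<close> avoids higher derivatives of \<open>Ln\<close>.\<close>

lemma smooth_on_angle:
  assumes T: "open T" and u: "\<And>y. y \<in> T \<Longrightarrow> u y \<in> cis ` {a<..<a + 2 * pi}" and sm: "smooth_on T u"
  shows "smooth_on T (\<lambda>y. inv_into {a<..<a + 2 * pi} cis (u y))"
proof (rule smooth_onI)
  have D: "((\<lambda>y. inv_into {a<..<a + 2 * pi} cis (u y)) has_derivative
      (\<lambda>v. Im (cnj (u x) * frechet_derivative u (at x) v))) (at x)" if "x \<in> T" for x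
    by (rule angle_has_derivative[OF T that u
          frechet_derivative_works[THEN iffD1, OF smooth_on_imp_differentiable[OF sm that]]])
  show "(\<lambda>y. inv_into {a<..<a + 2 * pi} cis (u y)) differentiable (at x)" if "x \<in> T" for x
    using D[OF that] by (rule differentiableI)
  fix v
  have "smooth_on T (\<lambda>x. Im (cnj (u x) * frechet_derivative u (at x) v))"
    by (intro smooth_on_bounded_linear_compose[OF T bounded_linear_Im] smooth_on_mult[OF T]
        smooth_on_bounded_linear_compose[OF T bounded_linear_cnj] sm smooth_on_frechet_derivative)
  then show "smooth_on T (\<lambda>x. frechet_derivative (\<lambda>y. inv_into {a<..<a + 2 * pi} cis (u y)) (at x) v)"
    by (rule smooth_on_cong[OF T, THEN iffD1, rotated]) (simp add: frechet_derivative_at[OF D, symmetric])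
qed

section \<open>Polar form\<close>

lemma polar_has_derivative:
  fixes \<theta> :: "'a::real_normed_vector \<Rightarrow> real"
  assumes "(\<theta> has_derivative \<theta>') (at y)"
  shows "((\<lambda>y. z * cis (\<theta> y)) has_derivative (\<lambda>v. (z * cis (\<theta> y)) * (\<i> * of_real (\<theta>' v)))) (at y)"
proof -
  have 1: "((\<lambda>y. \<i> * complex_of_real (\<theta> y)) has_derivative (\<lambda>v. \<i> * of_real (\<theta>' v))) (at y)"
    by (rule has_derivative_mult_right[OF bounded_linear.has_derivative[OF bounded_linear_of_real assms]])
  have "((\<lambda>y. exp (\<i> * complex_of_real (\<theta> y))) has_derivative
      (\<lambda>v. exp (\<i> * complex_of_real (\<theta> y)) * (\<i> * of_real (\<theta>' v)))) (at y)"
    using diff_chain_at[OF 1 DERIV_exp[unfolded has_field_derivative_def]] by (simp add: o_def)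
  from has_derivative_mult_right[OF this, of z] show ?thesis
    by (simp only: cis_conv_exp mult.assoc)
qed

lemma pderiv_at_polar:
  fixes \<theta> :: "real^'n \<Rightarrow> real"
  assumes "\<theta> differentiable (at y)"
  shows "pderiv_at j (\<lambda>y. z * cis (\<theta> y)) y = (z * cis (\<theta> y)) * (\<i> * of_real (pderiv_at j \<theta> y))"
  using pderiv_at_eqI[OF polar_has_derivative[OF frechet_derivative_works[THEN iffD1, OF assms]]]
  unfolding pderiv_at_def .

text \<open>Each differentiation multiplies u by i times the derivative of \<theta>. Two of them
  therefore contribute the square - (d_i \<theta>) (d_j \<theta>), the real part, next to the second
  derivative of \<theta>, the imaginary one.\<close>

lemma
  fixes \<theta> :: "real^'n \<Rightarrow> real"
  assumes T: "open T" "x \<in> T" and sm: "smooth_on T \<theta>" and u: "\<And>y. y \<in> T \<Longrightarrow> u y = z * cis (\<theta> y)"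
  shows second_order_op_polar: "second_order_op a b u x
      = u x * Complex (- gradient_product a \<theta> \<theta> x) (second_order_op a b \<theta> x)" (is ?P)
    and gradient_product_polar: "gradient_product a u u x
      = - (u x)\<^sup>2 * of_real (gradient_product a \<theta> \<theta> x)" (is ?Q)
proof -
  have 1: "pderiv_at j u y = \<i> * (u y * of_real (pderiv_at j \<theta> y))" if "y \<in> T" for j y
    using pderiv_at_cong_open[OF T(1) that u] pderiv_at_polar[OF smooth_on_imp_differentiable[OF sm that]] u[OF that]
    by (simp add: mult_ac)
  have "u differentiable (at x)"
  proof -
    have "(\<lambda>y. z * cis (\<theta> y)) differentiable (at x)"
      by (rule differentiableI[OF polar_has_derivative[OF frechet_derivative_works[THEN iffD1,
              OF smooth_on_imp_differentiable[OF sm T(2)]]]])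
    then show ?thesis
      by (rule differentiable_cong_open[OF T, THEN iffD2, rotated]) (simp add: u)
  qed
  moreover have pd: "pderiv_at j \<theta> differentiable (at x)" for j
    using smooth_on_imp_differentiable[OF smooth_on_pderiv_at[OF sm] T(2)] .
  moreover have pdC: "(\<lambda>y. complex_of_real (pderiv_at j \<theta> y)) differentiable (at x)" for j
    by (rule differentiable_compose[OF bounded_linear_imp_differentiable[OF bounded_linear_of_real] pd])
  ultimately have 2: "pderiv_at i (pderiv_at j u) x
      = u x * (\<i> * of_real (pderiv_at i (pderiv_at j \<theta>) x) - of_real (pderiv_at i \<theta> x * pderiv_at j \<theta> x))" for i j
    using pderiv_at_cong_open[where i = i, OF T 1[where j = j]] T(2)
    by (simp add: pderiv_at_bounded_linear[OF bounded_linear_mult_right] pderiv_at_mult 1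
        pderiv_at_bounded_linear[OF bounded_linear_of_real] algebra_simps)
  have s: "(\<Sum>i\<in>UNIV. \<Sum>j\<in>UNIV. a $ i $ j *\<^sub>R (w * f i j)) = w * (\<Sum>i\<in>UNIV. \<Sum>j\<in>UNIV. a $ i $ j *\<^sub>R f i j)"
    for w :: complex and f
    by (simp add: sum_distrib_left)
  have "(\<Sum>i\<in>UNIV. \<Sum>j\<in>UNIV. a $ i $ j *\<^sub>R pderiv_at i (pderiv_at j u) x)
     = u x * (\<i> * of_real (\<Sum>i\<in>UNIV. \<Sum>j\<in>UNIV. a $ i $ j * pderiv_at i (pderiv_at j \<theta>) x)
         - of_real (gradient_product a \<theta> \<theta> x))"
    unfolding 2 s
    by (simp add: scaleR_diff_right sum_subtractf s gradient_product_def)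
      (simp add: scaleR_conv_of_real)
  moreover have "(\<Sum>k\<in>UNIV. b $ k *\<^sub>R pderiv_at k u x)
     = u x * (\<i> * of_real (\<Sum>k\<in>UNIV. b $ k * pderiv_at k \<theta> x))"
    unfolding 1[OF T(2)] by (simp add: sum_distrib_left scaleR_conv_of_real mult_ac)
  ultimately have "second_order_op a b u x
      = u x * (\<i> * of_real (second_order_op a b \<theta> x) - of_real (gradient_product a \<theta> \<theta> x))"
    by (simp add: second_order_op_def distrib_left right_diff_distrib)
  then show ?P by (simp add: complex_eq_iff)
  have sq: "\<i> * (u x * of_real r) * (\<i> * (u x * of_real s)) = - (u x)\<^sup>2 * of_real (r * s)" for r s
    by (simp add: complex_eq_iff power2_eq_square algebra_simps)
  have "gradient_product a u u x
     = (\<Sum>i\<in>UNIV. \<Sum>j\<in>UNIV. a $ i $ j *\<^sub>R (- (u x)\<^sup>2 * of_real (pderiv_at i \<theta> x * pderiv_at j \<theta> x)))"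
    unfolding gradient_product_def 1[OF T(2)] sq ..
  then show ?Q
    unfolding s by (simp add: gradient_product_def scaleR_conv_of_real)
qed

text \<open>For \<open>D = d\<theta>\<close> the horizontal space is spanned by \<open>\<nabla>\<theta>\<close>, and \<open>D\<close> maps it isometrically
  onto the line with metric \<open>dt\<^sup>2 / k\<close> iff \<open>|\<nabla>\<theta>|\<^sup>2 = k\<close>.\<close>

lemma horizontal_isometry_iff:
  fixes G :: "real^'n^'n" and D :: "real^'n \<Rightarrow> real^1" and q :: "real^'n"
  assumes sym: "transpose G = G" and pd: "\<And>v. v \<noteq> 0 \<Longrightarrow> 0 < v \<bullet> (G *v v)"
    and D: "\<And>v. D v = vec (q \<bullet> v)" and k: "k > 0"
    and H: "H = {v. \<forall>u. D u = 0 \<longrightarrow> v \<bullet> (G *v u) = 0}"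
  shows "(surj D \<and> (\<forall>v\<in>H. \<forall>w\<in>H. D v \<bullet> (((1/k) *\<^sub>R mat 1) *v D w) = v \<bullet> (G *v w)))
    \<longleftrightarrow> q \<bullet> (matrix_inv G *v q) = k"
proof -
  \<comment> \<open>The G-gradient of the linear form given by q.\<close>
  define w0 where "w0 = matrix_inv G *v q"
  have inv: "invertible G" by (rule posdef_imp_invertible[OF pd])
  have Gw0: "G *v w0 = q" using inv by (simp add: w0_def matrix_vector_mul_assoc matrix_inv_right)
  have comm: "v \<bullet> (G *v w) = w \<bullet> (G *v v)" for v w
    by (rule inner_matrix_vector_mult_commute[OF sym])
  have KD: "D v \<bullet> (((1/k) *\<^sub>R mat 1) *v D w) = (q \<bullet> v) * (q \<bullet> w) / k" for v w
    by (simp add: D inner_vec_def scaleR_matrix_vector_assoc[symmetric])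
  have D0: "D u = 0 \<longleftrightarrow> q \<bullet> u = 0" for u by (simp add: D vec_eq_iff)
  have w0H: "w0 \<in> H"
    unfolding H using comm[of w0] by (simp add: Gw0 D0 inner_commute)
  show ?thesis unfolding w0_def[symmetric]
  proof
    assume *: "surj D \<and> (\<forall>v\<in>H. \<forall>w\<in>H. D v \<bullet> (((1/k) *\<^sub>R mat 1) *v D w) = v \<bullet> (G *v w))"
    \<comment> \<open>For q = 0 the horizontal space is 0 and the isometry condition holds
      vacuously; surjectivity excludes this.\<close>
    have "q \<noteq> 0"
    proof
      assume "q = 0"
      then have "D v = 0" for v by (simp add: D0)
      moreover obtain v where "D v = vec 1" using * by (metis surjD)
      ultimately show False by (simp add: vec_eq_iff)
    qed
    then have pos: "q \<bullet> w0 > 0" unfolding w0_def by (intro posdef_matrix_inv pd)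
    have "(q \<bullet> w0) * (q \<bullet> w0) / k = q \<bullet> w0"
      using * w0H KD[of w0 w0] by (metis Gw0 inner_commute)
    then show "q \<bullet> w0 = k" using pos k by (simp add: field_simps)
  next
    assume e: "q \<bullet> w0 = k"
    have "D ((y $ 1 / k) *\<^sub>R w0) = y" for y
      using e k by (simp add: D vec_eq_iff)
    then have "surj D" by (rule surjI)
    \<comment> \<open>The remainder u lies in the kernel of D; as v and w0 are both orthogonal to
      that kernel, u is orthogonal to itself.\<close>
    moreover have span: "v = (q \<bullet> v / k) *\<^sub>R w0" if "v \<in> H" for v
    proof -
      define u where "u = v - (q \<bullet> v / k) *\<^sub>R w0"
      have qu: "q \<bullet> u = 0" using e k by (simp add: u_def inner_diff_right)
      then have "v \<bullet> (G *v u) = 0" using that by (simp add: H D0)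
      moreover have "w0 \<bullet> (G *v u) = 0" using comm[of w0 u] qu by (simp add: Gw0 inner_commute)
      ultimately have "u \<bullet> (G *v u) = 0" by (simp add: u_def inner_diff_left)
      then have "u = 0" using pd[of u] by force
      then show ?thesis by (simp add: u_def)
    qed
    moreover have "D v \<bullet> (((1/k) *\<^sub>R mat 1) *v D w) = v \<bullet> (G *v w)" if "v \<in> H" "w \<in> H" for v w
    proof -
      have "v \<bullet> (G *v w) = ((q \<bullet> v / k) *\<^sub>R w0) \<bullet> (G *v ((q \<bullet> w / k) *\<^sub>R w0))"
        using span that by metis
      also have "\<dots> = (q \<bullet> v / k) * (q \<bullet> w / k) * (w0 \<bullet> q)"
        by (simp add: matrix_vector_mult_scaleR Gw0)
      also have "\<dots> = (q \<bullet> v) * (q \<bullet> w) / k"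
        using e k by (simp add: inner_commute)
      finally show ?thesis unfolding KD by simp
    qed
    ultimately show "surj D \<and> (\<forall>v\<in>H. \<forall>w\<in>H. D v \<bullet> (((1/k) *\<^sub>R mat 1) *v D w) = v \<bullet> (G *v w))"
      by blast
  qed
qed

subsection \<open>Functions on the manifold\<close>

context smooth_manifold
begin

lemma chart_map_in_img: "p \<in> chart_dom c \<Longrightarrow> chart_map c p \<in> chart_img c"
  by (simp add: chart_img_def)

lemma chart_inv_chart_map: "c \<in> A \<Longrightarrow> p \<in> chart_dom c \<Longrightarrow> chart_inv c (chart_map c p) = p"
  using chart_homeo[of c] by (auto simp: homeomorphism_def)

lemma chart_map_chart_inv: "c \<in> A \<Longrightarrow> x \<in> chart_img c \<Longrightarrow> chart_map c (chart_inv c x) = x"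
  using chart_homeo[of c] by (auto simp: homeomorphism_def)

lemma chart_inv_in_dom: "c \<in> A \<Longrightarrow> x \<in> chart_img c \<Longrightarrow> chart_inv c x \<in> chart_dom c"
  using chart_homeo[of c] by (auto simp: homeomorphism_def)

lemma chart_dom_subset: "c \<in> A \<Longrightarrow> chart_dom c \<subseteq> M"
  using covers by blast

lemma chart_at:
  assumes "p \<in> M"
  obtains c where "c \<in> A" "p \<in> chart_dom c"
  using assms covers by blast

lemma openin_chart_preimage:
  assumes "c \<in> A" "open U"
  shows "openin (top_of_set M) (chart_dom c \<inter> chart_map c -` U)"
proof -
  have "continuous_on (chart_dom c) (chart_map c)"
    using chart_homeo[OF assms(1)] by (simp add: homeomorphism_def)
  then have "openin (top_of_set (chart_dom c)) (chart_dom c \<inter> chart_map c -` U)"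
    using assms(2) by (rule continuous_openin_preimage_gen)
  then show ?thesis using dom_open[OF assms(1)] by (rule openin_trans)
qed

text \<open>\<open>smooth_function\<close> speaks of coordinate expressions only; preimages of open
  sets are glued together over the chart domains.\<close>

lemma smooth_function_imp_continuous_on:
  assumes "smooth_function A f"
  shows "continuous_on M f"
proof -
  have *: "openin (top_of_set M) (M \<inter> f -` B)" if "open B" for B
  proof -
    have "openin (top_of_set M) (chart_dom c \<inter> chart_map c -` (chart_img c \<inter> (f \<circ> chart_inv c) -` B))"
      if c: "c \<in> A" for c
      using assms c unfolding smooth_function_def
      by (intro openin_chart_preimage c continuous_open_preimage smooth_on_imp_continuous_on img_open \<open>open B\<close>) auto
    moreover have "chart_dom c \<inter> chart_map c -` (chart_img c \<inter> (f \<circ> chart_inv c) -` B) = chart_dom c \<inter> f -` B"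
      if c: "c \<in> A" for c
      using chart_inv_chart_map[OF c] chart_map_in_img[of _ c] by auto
    ultimately have "openin (top_of_set M) (\<Union>c\<in>A. chart_dom c \<inter> f -` B)"
      by (intro openin_Union) auto
    moreover have "(\<Union>c\<in>A. chart_dom c \<inter> f -` B) = M \<inter> f -` B" using covers by blast
    ultimately show ?thesis by simp
  qed
  show ?thesis
    unfolding continuous_on_open_invariant
  proof (intro allI impI)
    fix B :: "'b set" assume "open B"
    then obtain U where "open U" "M \<inter> f -` B = M \<inter> U" using * unfolding openin_open by blast
    then show "\<exists>U. open U \<and> U \<inter> M = f -` B \<inter> M" by (intro exI[of _ U]) auto
  qed
qed

end

context riemannian_manifold
begin

text \<open>The set where the maximum is attained is closed by continuity and open by the local
  maximum principle in a chart, hence all of the connected M.\<close>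

lemma subharmonic_imp_constant:
  fixes f :: "'a \<Rightarrow> real"
  assumes "compact M" "connected M" and sm: "smooth_function A f"
    and L: "\<And>c x. c \<in> A \<Longrightarrow> x \<in> chart_img c \<Longrightarrow>
      0 \<le> second_order_op (inv_metric g c x) (drift g c x) (f \<circ> chart_inv c) x"
  shows "f constant_on M"
proof (cases "M = {}")
  case True
  then show ?thesis by (simp add: constant_on_def)
next
  case False
  have cont: "continuous_on M f" by (rule smooth_function_imp_continuous_on[OF sm])
  obtain p0 where p0: "p0 \<in> M" "\<And>p. p \<in> M \<Longrightarrow> f p \<le> f p0"
    using continuous_attains_sup[OF assms(1) False cont] by blast
  define K where "K = {p \<in> M. f p = f p0}"
  have "closedin (top_of_set M) K"
    unfolding K_def using continuous_closedin_preimage_constant[OF cont] .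
  moreover have "openin (top_of_set M) K"
  proof (subst openin_subopen, intro ballI)
    fix p assume p: "p \<in> K"
    then obtain c where c: "c \<in> A" "p \<in> chart_dom c" using chart_at unfolding K_def by blast
    define x where "x = chart_map c p"
    have x: "x \<in> chart_img c" "chart_inv c x = p"
      using chart_map_in_img[OF c(2)] chart_inv_chart_map[OF c] by (auto simp: x_def)
    have max: "(f \<circ> chart_inv c) y \<le> (f \<circ> chart_inv c) x" if "y \<in> chart_img c" for y
      using p0(2) chart_inv_in_dom[OF c(1) that] chart_dom_subset[OF c(1)] p x(2) by (auto simp: K_def)
    have "smooth_on (chart_img c) (f \<circ> chart_inv c)"
      using sm c(1) by (simp add: smooth_function_def)
    then have "\<exists>r>0. \<forall>y\<in>ball x r. (f \<circ> chart_inv c) y = (f \<circ> chart_inv c) x"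
    proof (rule strong_maximum_principle_local[OF img_open[OF c(1)] x(1) _ max
        continuous_on_inv_metric[OF c(1)] continuous_on_drift[OF c(1)]
        inv_metric_sym[OF c(1)] inv_metric_pos[OF c(1)] L[OF c(1)]])
      fix r :: real
      assume "r > 0" "\<And>y. y \<in> ball x r \<Longrightarrow> (f \<circ> chart_inv c) y = (f \<circ> chart_inv c) x"
      then show ?thesis by (intro exI[of _ r] conjI ballI)
    qed
    then obtain r where r: "r > 0"
        "\<And>y. y \<in> ball x r \<Longrightarrow> (f \<circ> chart_inv c) y = (f \<circ> chart_inv c) x"
      by blast
    have "chart_dom c \<inter> chart_map c -` ball x r \<subseteq> K"
    proof
      fix q assume q: "q \<in> chart_dom c \<inter> chart_map c -` ball x r"
      then have "f q = f p"
        using r(2)[of "chart_map c q"] chart_inv_chart_map[OF c(1), of q] x(2) by simp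
      then show "q \<in> K" using q p chart_dom_subset[OF c(1)] by (auto simp: K_def)
    qed
    moreover have "p \<in> chart_dom c \<inter> chart_map c -` ball x r"
      using c r(1) by (simp add: x_def)
    ultimately show "\<exists>T. openin (top_of_set M) T \<and> p \<in> T \<and> T \<subseteq> K"
      using openin_chart_preimage[OF c(1) open_ball] by blast
  qed
  moreover have "p0 \<in> K" using p0 by (simp add: K_def)
  ultimately have "K = M" using assms(2) unfolding connected_clopen by blast
  then show ?thesis unfolding K_def constant_on_def by blast
qed

section \<open>Eigenfunctions have constant modulus\<close>

lemma gradient_product_eq_inner:
  fixes f h :: "real^'n \<Rightarrow> real"
  shows "gradient_product a f h x = (\<chi> i. pderiv_at i f x) \<bullet> (a *v (\<chi> i. pderiv_at i h x))"
  by (simp add: gradient_product_def inner_matrix_vector_mult_eq_sum)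

text \<open>With \<open>\<phi> = p + i q\<close> the eigenfunction equations give
  \<open>\<Delta>|\<phi>|\<^sup>2 = 2 \<lambda> |\<phi>|\<^sup>2 + 2 (|\<nabla>p|\<^sup>2 + |\<nabla>q|\<^sup>2)\<close>, which is nonnegative by the
  Cauchy-Schwarz inequality for \<open>\<nabla>p\<close> and \<open>\<nabla>q\<close>.\<close>

lemma eigenfunction_norm_constant:
  assumes "compact M" "connected M"
    and eig: "eigenfunction A g (complex_of_real lam) (complex_of_real lam) \<phi>"
  shows "(\<lambda>p. (Re (\<phi> p))\<^sup>2 + (Im (\<phi> p))\<^sup>2) constant_on M"
proof (rule subharmonic_imp_constant[OF assms(1,2)])
  let ?f = "\<lambda>p. (Re (\<phi> p))\<^sup>2 + (Im (\<phi> p))\<^sup>2"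
  have sm: "smooth_on (chart_img c) (\<phi> \<circ> chart_inv c)" if "c \<in> A" for c
    using eig[unfolded eigenfunction_def smooth_function_def, THEN conjunct1, THEN bspec, OF that] .
  define P where "P = (\<lambda>(c::('a, 'n) chart) x. Re ((\<phi> \<circ> chart_inv c) x))"
  define Q where "Q = (\<lambda>(c::('a, 'n) chart) x. Im ((\<phi> \<circ> chart_inv c) x))"
  have smP: "smooth_on (chart_img c) (P c)" and smQ: "smooth_on (chart_img c) (Q c)" if "c \<in> A" for c
    unfolding P_def Q_def
    using smooth_on_bounded_linear_compose[OF img_open[OF that] bounded_linear_Re sm[OF that]]
      smooth_on_bounded_linear_compose[OF img_open[OF that] bounded_linear_Im sm[OF that]] .
  have smPP: "smooth_on (chart_img c) (\<lambda>x. P c x * P c x)"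
    and smQQ: "smooth_on (chart_img c) (\<lambda>x. Q c x * Q c x)" if "c \<in> A" for c
    using smooth_on_mult[OF img_open[OF that] smP[OF that] smP[OF that]]
      smooth_on_mult[OF img_open[OF that] smQ[OF that] smQ[OF that]] .
  have f: "?f \<circ> chart_inv c = (\<lambda>x. P c x * P c x + Q c x * Q c x)" for c
    by (simp add: P_def Q_def o_def power2_eq_square)
  show "smooth_function A ?f"
    unfolding smooth_function_def f using smooth_on_add[OF img_open smPP smQQ] by blast
  fix c x assume c: "c \<in> A" and x: "x \<in> chart_img c"
  define a where "a = inv_metric g c x"
  define b where "b = drift g c x"
  define u where "u = \<phi> \<circ> chart_inv c"
  note S = img_open[OF c] x
  have sym: "transpose a = a" unfolding a_def by (rule inv_metric_sym[OF c x])
  have psd: "0 \<le> v \<bullet> (a *v v)" for v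
    using inv_metric_pos[OF c x, of v] unfolding a_def by (cases "v = 0") auto
  have smu: "smooth_on (chart_img c) u" unfolding u_def by (rule sm[OF c])
  have Px: "P c = (\<lambda>x. Re (u x))" and Qx: "Q c = (\<lambda>x. Im (u x))" by (simp_all add: P_def Q_def u_def fun_eq_iff)
  have "laplace_beltrami g c \<phi> (chart_map c (chart_inv c x)) = of_real lam * \<phi> (chart_inv c x) \<and>
      conformality g c \<phi> \<phi> (chart_map c (chart_inv c x)) = of_real lam * (\<phi> (chart_inv c x))\<^sup>2"
    by (rule eig[unfolded eigenfunction_def, THEN conjunct2, THEN bspec, OF c, THEN bspec,
          OF chart_inv_in_dom[OF c x]])
  then have eqs: "second_order_op a b u x = of_real lam * u x" "gradient_product a u u x = of_real lam * (u x)\<^sup>2"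
    unfolding chart_map_chart_inv[OF c x] laplace_beltrami_eq_second_order_op[OF c x sm[OF c]]
      conformality_eq_gradient_product[OF c x]
    by (simp_all add: a_def b_def u_def)
  have LP: "second_order_op a b (P c) x = lam * P c x"
    using second_order_op_bounded_linear[OF S smu bounded_linear_Re, of a b] by (simp add: Px eqs)
  have LQ: "second_order_op a b (Q c) x = lam * Q c x"
    using second_order_op_bounded_linear[OF S smu bounded_linear_Im, of a b] by (simp add: Qx eqs)
  define PP where "PP = gradient_product a (P c) (P c) x"
  define QQ where "QQ = gradient_product a (Q c) (Q c) x"
  define PQ where "PQ = gradient_product a (P c) (Q c) x"
  have QP: "gradient_product a (Q c) (P c) x = PQ"
    unfolding PQ_def gradient_product_eq_inner by (rule inner_matrix_vector_mult_commute[OF sym])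
  have nn: "PP \<ge> 0" "QQ \<ge> 0" and CS: "PQ\<^sup>2 \<le> PP * QQ"
    unfolding PP_def QQ_def PQ_def gradient_product_eq_inner
    using psd psd_Cauchy_Schwarz[OF sym psd] by blast+
  have Rd: "pderiv_at i (P c) x = Re (pderiv_at i u x)" and Id: "pderiv_at i (Q c) x = Im (pderiv_at i u x)" for i
    unfolding Px Qx
    by (simp_all add: pderiv_at_bounded_linear[OF bounded_linear_Re]
        pderiv_at_bounded_linear[OF bounded_linear_Im] smooth_on_imp_differentiable[OF smu x])
  have "Re (gradient_product a u u x) = PP - QQ"
    by (simp add: gradient_product_def PP_def QQ_def Rd Id right_diff_distrib sum_subtractf)
  then have e1: "PP - QQ = lam * ((P c x)\<^sup>2 - (Q c x)\<^sup>2)"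
    by (simp add: eqs Px Qx power2_eq_square)
  have "Im (gradient_product a u u x) = PQ + PQ"
    by (subst (2) QP[symmetric])
      (simp add: gradient_product_def PQ_def Rd Id distrib_left sum.distrib mult_ac)
  then have e2: "PQ = lam * (P c x * Q c x)"
    by (simp add: eqs Px Qx power2_eq_square mult_ac)
  \<comment> \<open>The right side is the squared modulus of kappa(phi, phi). Replacing PQ^2 by its
    bound PP QQ completes the square (PP + QQ)^2.\<close>
  have "(- lam * ((P c x)\<^sup>2 + (Q c x)\<^sup>2))\<^sup>2 = (PP - QQ)\<^sup>2 + 4 * PQ\<^sup>2"
    unfolding e1 e2 by (simp add: power2_eq_square algebra_simps)
  also have "\<dots> \<le> (PP + QQ)\<^sup>2"
    using CS by (simp add: power2_eq_square algebra_simps)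
  finally have ineq: "- lam * ((P c x)\<^sup>2 + (Q c x)\<^sup>2) \<le> PP + QQ"
    by (rule power2_le_imp_le) (simp add: nn)
  have "second_order_op a b (?f \<circ> chart_inv c) x
      = 2 * (lam * ((P c x)\<^sup>2 + (Q c x)\<^sup>2)) + 2 * (PP + QQ)"
    unfolding f second_order_op_add[OF S smPP[OF c] smQQ[OF c]]
      second_order_op_mult[OF S smP[OF c] smP[OF c] sym] second_order_op_mult[OF S smQ[OF c] smQ[OF c] sym]
      LP LQ PP_def[symmetric] QQ_def[symmetric]
    by (simp add: power2_eq_square algebra_simps)
  then show "0 \<le> second_order_op (inv_metric g c x) (drift g c x) (?f \<circ> chart_inv c) x"
    using ineq unfolding a_def b_def by (simp add: algebra_simps)
qed

end

subsection \<open>Maps to the circle\<close>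

text \<open>The local \<theta>, kept real valued so that scalar calculus applies;
  \<open>local_rep_angle_chart\<close> restores the \<open>vec\<close>.\<close>

definition angle_rep :: "real \<Rightarrow> ('a, 'n::finite) chart \<Rightarrow> ('a \<Rightarrow> complex) \<Rightarrow> real^'n \<Rightarrow> real" where
  "angle_rep \<alpha> c F y = inv_into {\<alpha><..<\<alpha> + 2 * pi} cis (F (chart_inv c y))"

lemma bounded_linear_vec: "bounded_linear (vec :: real \<Rightarrow> real^1)"
  by (intro linear_conv_bounded_linear[THEN iffD1] linearI) (simp_all add: vec_eq_iff)

lemma chart_dom_angle_chart: "chart_dom (angle_chart \<alpha>) = circle - {cis \<alpha>}"
  by (simp add: angle_chart_def cis_image_open_interval)

lemma local_rep_angle_chart: "local_rep c (angle_chart \<alpha>) F = (\<lambda>y. vec (angle_rep \<alpha> c F y))"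
  by (simp add: local_rep_def angle_chart_def angle_rep_def fun_eq_iff)

text \<open>The chart that omits the antipode of z contains z.\<close>

lemma angle_chart_at:
  assumes "z \<in> circle"
  obtains \<alpha> where "z \<in> chart_dom (angle_chart \<alpha>)"
proof -
  have "norm z = 1" using assms by simp
  then have "z \<noteq> 0" by auto
  then have z: "z = cis (Arg z)" using cis_Arg[of z] \<open>norm z = 1\<close> by (simp add: sgn_div_norm)
  have "cis (Arg z + pi) = - z" by (subst (2) z) (simp add: cis_mult[symmetric])
  moreover have "z \<noteq> - z" using \<open>norm z = 1\<close> by auto
  ultimately have "z \<in> chart_dom (angle_chart (Arg z + pi))" using assms by (simp add: chart_dom_angle_chart)
  then show thesis by (rule that)
qed

context riemannian_manifold
begin

context
  fixes F :: "'a \<Rightarrow> complex"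
  assumes smF: "smooth_function A F" and circ: "F ` M \<subseteq> circle"
begin

text \<open>An open condition on coordinates; \<open>angle_dom_eq_image\<close> identifies it with
  the image set over which \<open>smooth_map\<close> quantifies.\<close>

definition angle_dom :: "real \<Rightarrow> ('a, 'n) chart \<Rightarrow> (real^'n) set" where
  "angle_dom \<alpha> c = {x \<in> chart_img c. F (chart_inv c x) \<noteq> cis \<alpha>}"

lemma smooth_on_F_chart: "c \<in> A \<Longrightarrow> smooth_on (chart_img c) (F \<circ> chart_inv c)"
  using smF unfolding smooth_function_def by (rule bspec)

lemma F_chart_in_circle: "c \<in> A \<Longrightarrow> x \<in> chart_img c \<Longrightarrow> F (chart_inv c x) \<in> circle"
  using circ chart_inv_in_dom chart_dom_subset by blast

lemma open_angle_dom:
  assumes "c \<in> A"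
  shows "open (angle_dom \<alpha> c)"
proof -
  have "open (chart_img c \<inter> (F \<circ> chart_inv c) -` (- {cis \<alpha>}))"
    by (rule continuous_open_preimage[OF smooth_on_imp_continuous_on[OF smooth_on_F_chart[OF assms]]
          img_open[OF assms]]) (simp add: open_Compl)
  moreover have "chart_img c \<inter> (F \<circ> chart_inv c) -` (- {cis \<alpha>}) = angle_dom \<alpha> c"
    by (auto simp: angle_dom_def)
  ultimately show ?thesis by simp
qed

lemma angle_dom_eq_image:
  assumes "c \<in> A"
  shows "chart_map c ` (chart_dom c \<inter> F -` chart_dom (angle_chart \<alpha>)) = angle_dom \<alpha> c"
proof (intro equalityI subsetI)
  fix x assume "x \<in> chart_map c ` (chart_dom c \<inter> F -` chart_dom (angle_chart \<alpha>))"
  then show "x \<in> angle_dom \<alpha> c"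
    using chart_map_in_img[of _ c] chart_inv_chart_map[OF assms]
    by (auto simp: angle_dom_def chart_dom_angle_chart)
next
  fix x assume x: "x \<in> angle_dom \<alpha> c"
  then have "chart_inv c x \<in> chart_dom c \<inter> F -` chart_dom (angle_chart \<alpha>)"
    using F_chart_in_circle[OF assms, of x] chart_inv_in_dom[OF assms, of x]
    by (auto simp: angle_dom_def chart_dom_angle_chart)
  moreover have "x = chart_map c (chart_inv c x)"
    using x chart_map_chart_inv[OF assms, of x] by (simp add: angle_dom_def)
  ultimately show "x \<in> chart_map c ` (chart_dom c \<inter> F -` chart_dom (angle_chart \<alpha>))" by blast
qed

lemma F_chart_in_cis_image:
  "c \<in> A \<Longrightarrow> y \<in> angle_dom \<alpha> c \<Longrightarrow> F (chart_inv c y) \<in> cis ` {\<alpha><..<\<alpha> + 2 * pi}"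
  using F_chart_in_circle[of c y] unfolding cis_image_open_interval by (simp add: angle_dom_def)

lemma smooth_on_angle_rep:
  assumes "c \<in> A"
  shows "smooth_on (angle_dom \<alpha> c) (angle_rep \<alpha> c F)"
proof -
  have "smooth_on (angle_dom \<alpha> c) (F \<circ> chart_inv c)"
    by (rule smooth_on_subset[OF smooth_on_F_chart[OF assms]]) (auto simp: angle_dom_def)
  from smooth_on_angle[where a = \<alpha>, OF open_angle_dom[OF assms] _ this]
  show ?thesis
    using F_chart_in_cis_image[OF assms] by (simp add: angle_rep_def[abs_def])
qed

lemma cis_angle_rep: "c \<in> A \<Longrightarrow> y \<in> angle_dom \<alpha> c \<Longrightarrow> cis (angle_rep \<alpha> c F y) = F (chart_inv c y)"
  unfolding angle_rep_def by (rule cis_inv_into[OF F_chart_in_cis_image])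

lemma smooth_map_circle: "smooth_map M A circle circle_atlas F"
  unfolding smooth_map_def
proof (intro conjI ballI)
  show "F ` M \<subseteq> circle" by (rule circ)
  show "continuous_on M F" by (rule smooth_function_imp_continuous_on[OF smF])
  fix c d assume c: "c \<in> A" and "d \<in> circle_atlas"
  then obtain \<alpha> where d: "d = angle_chart \<alpha>" unfolding circle_atlas_def by blast
  show "smooth_on (chart_map c ` (chart_dom c \<inter> F -` chart_dom d)) (chart_map d \<circ> F \<circ> chart_inv c)"
    unfolding d angle_dom_eq_image[OF c] local_rep_def[symmetric] local_rep_angle_chart
    by (rule smooth_on_bounded_linear_compose[OF open_angle_dom[OF c] bounded_linear_vec smooth_on_angle_rep[OF c]])
qed

text \<open>The squared length of grad \<theta>, twice the usual energy density of F as a map to the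
  unit circle.\<close>

definition energy :: "real \<Rightarrow> ('a, 'n) chart \<Rightarrow> real^'n \<Rightarrow> real" where
  "energy \<alpha> c x = gradient_product (inv_metric g c x) (angle_rep \<alpha> c F) (angle_rep \<alpha> c F) x"

context
  fixes c \<alpha> p
  assumes c: "c \<in> A" and p: "p \<in> chart_dom c" and Fp: "F p \<in> chart_dom (angle_chart \<alpha>)"
begin

lemma point_in_angle_dom: "chart_map c p \<in> angle_dom \<alpha> c"
  using angle_dom_eq_image[OF c, of \<alpha>] p Fp by blast

text \<open>The differential of F is the linear form of q, the coordinate differential of the angle,
  so \<open>horizontal_isometry_iff\<close> applies.\<close>

lemma riemannian_submersion_at_iff:
  assumes "k > 0"
  shows "(let G = g c (chart_map c p);
            K = circle_metric (1 / k) (angle_chart \<alpha>) (chart_map (angle_chart \<alpha>) (F p));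
            D = frechet_derivative (local_rep c (angle_chart \<alpha>) F) (at (chart_map c p));
            H = {v. \<forall>u. D u = 0 \<longrightarrow> v \<bullet> (G *v u) = 0}
        in surj D \<and> (\<forall>v\<in>H. \<forall>w\<in>H. D v \<bullet> (K *v D w) = v \<bullet> (G *v w)))
    \<longleftrightarrow> energy \<alpha> c (chart_map c p) = k"
proof -
  define x where "x = chart_map c p"
  define q where "q = (\<chi> j. pderiv_at j (angle_rep \<alpha> c F) x)"
  have x: "x \<in> chart_img c" unfolding x_def by (rule chart_map_in_img[OF p])
  have d: "angle_rep \<alpha> c F differentiable (at x)"
    unfolding x_def by (rule smooth_on_imp_differentiable[OF smooth_on_angle_rep[OF c] point_in_angle_dom])
  from frechet_derivative_at[OF bounded_linear.has_derivative[OF bounded_linear_vec frechet_derivative_works[THEN iffD1, OF d]]]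
  have D: "frechet_derivative (local_rep c (angle_chart \<alpha>) F) (at x) v = vec (q \<bullet> v)" for v
    unfolding local_rep_angle_chart
    by (simp add: fun_eq_iff frechet_derivative_eq_sum_pderiv[OF d] q_def inner_vec_def mult.commute)
  have "energy \<alpha> c x = q \<bullet> (matrix_inv (g c x) *v q)"
    by (simp add: energy_def gradient_product_eq_inner q_def inv_metric_def)
  then show ?thesis
    unfolding x_def[symmetric] Let_def circle_metric_def
    using horizontal_isometry_iff[OF metric_sym[OF c x] metric_pos[OF c x] D assms refl] by simp
qed

text \<open>The constant z stands for the modulus by which F is scaled to phi; r is free since the
  tension field does not see it.\<close>

lemma laplace_beltrami_polar:
  "laplace_beltrami g c (\<lambda>x. z * F x) (chart_map c p)
    = z * F p * Complex (- energy \<alpha> c (chart_map c p))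
        (tension_field g (circle_metric r) c (angle_chart \<alpha>) F (chart_map c p) $ 1)" (is ?L)
  and conformality_polar:
  "conformality g c (\<lambda>x. z * F x) (\<lambda>x. z * F x) (chart_map c p)
    = - (z * F p)\<^sup>2 * of_real (energy \<alpha> c (chart_map c p))" (is ?C)
proof -
  define x where "x = chart_map c p"
  have x: "x \<in> chart_img c" "chart_inv c x = p"
    unfolding x_def using chart_map_in_img[OF p] chart_inv_chart_map[OF c p] by auto
  have sm: "smooth_on (chart_img c) ((\<lambda>x. z * F x) \<circ> chart_inv c)"
    using smooth_on_bounded_linear_compose[OF img_open[OF c] bounded_linear_mult_right smooth_on_F_chart[OF c], of z]
    by (simp add: o_def)
  have u: "((\<lambda>x. z * F x) \<circ> chart_inv c) y = z * cis (angle_rep \<alpha> c F y)" if "y \<in> angle_dom \<alpha> c" for y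
    using cis_angle_rep[OF c that] by simp
  note polar = open_angle_dom[OF c, of \<alpha>] point_in_angle_dom[folded x_def] smooth_on_angle_rep[OF c, of \<alpha>] u
  have Lx: "second_order_op a b ((\<lambda>x. z * F x) \<circ> chart_inv c) x
      = z * F p * Complex (- gradient_product a (angle_rep \<alpha> c F) (angle_rep \<alpha> c F) x)
          (second_order_op a b (angle_rep \<alpha> c F) x)" for a b
    using second_order_op_polar[OF polar, of a b] by (simp add: x(2) o_def)
  have Cx: "gradient_product a ((\<lambda>x. z * F x) \<circ> chart_inv c) ((\<lambda>x. z * F x) \<circ> chart_inv c) x
      = - (z * F p)\<^sup>2 * of_real (gradient_product a (angle_rep \<alpha> c F) (angle_rep \<alpha> c F) x)" for a
    using gradient_product_polar[OF polar, of a] by (simp add: x(2) o_def)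
  show ?L
    unfolding x_def[symmetric] laplace_beltrami_eq_second_order_op[OF c x(1) sm] Lx
      tension_field_circle_eq_second_order_op local_rep_angle_chart
    by (simp add: energy_def)
  show ?C
    unfolding x_def[symmetric] conformality_eq_gradient_product[OF c x(1)] Cx
    by (simp add: energy_def)
qed

text \<open>After division by z * F p, the real part of the tau equation fixes the energy and its
  imaginary part the tension; the kappa equation fixes the same energy.\<close>

lemma eigen_equations_iff:
  assumes "z \<noteq> 0"
  shows "laplace_beltrami g c (\<lambda>x. z * F x) (chart_map c p) = of_real lam * (z * F p) \<and>
      conformality g c (\<lambda>x. z * F x) (\<lambda>x. z * F x) (chart_map c p) = of_real lam * (z * F p)\<^sup>2
    \<longleftrightarrow> tension_field g (circle_metric r) c (angle_chart \<alpha>) F (chart_map c p) = 0 \<and>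
      energy \<alpha> c (chart_map c p) = - lam"
proof -
  have "F p \<noteq> 0" using Fp by (auto simp: chart_dom_angle_chart)
  then have nz: "z * F p \<noteq> 0" using assms by simp
  have L: "z * F p * w = of_real lam * (z * F p) \<longleftrightarrow> w = of_real lam" for w
    using nz by (metis mult.commute mult_cancel_left)
  have C: "- (z * F p)\<^sup>2 * of_real e = of_real lam * (z * F p)\<^sup>2 \<longleftrightarrow> e = - lam" for e
  proof -
    have "- (z * F p)\<^sup>2 * of_real e = of_real lam * (z * F p)\<^sup>2
        \<longleftrightarrow> (z * F p)\<^sup>2 * complex_of_real (- e) = (z * F p)\<^sup>2 * of_real lam"
      by (simp add: mult.commute)
    also have "\<dots> \<longleftrightarrow> - e = lam"
      using nz by (simp only: mult_cancel_left of_real_eq_iff power_eq_0_iff) simp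
    finally show ?thesis by auto
  qed
  have t: "t = 0 \<longleftrightarrow> t $ 1 = 0" for t :: "real^1" by (simp add: vec_eq_iff)
  have "Complex (- e) s = of_real lam \<longleftrightarrow> s = 0 \<and> e = - lam" for e s
    by (auto simp: complex_eq_iff)
  then show ?thesis
    unfolding laplace_beltrami_polar[of z r] conformality_polar L C t[of "tension_field _ _ _ _ _ _"] by blast
qed

end

text \<open>If the value \<open>cis \<alpha>\<close> is omitted, a global angle function exists; it has a critical point.\<close>

lemma surj_circle_if_energy_nonzero:
  assumes "compact M" "M \<noteq> {}"
    and energy: "\<And>c \<alpha> p. c \<in> A \<Longrightarrow> p \<in> chart_dom c \<Longrightarrow> F p \<in> chart_dom (angle_chart \<alpha>) \<Longrightarrow>
      energy \<alpha> c (chart_map c p) \<noteq> 0"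
  shows "F ` M = circle"
proof (rule ccontr)
  assume "F ` M \<noteq> circle"
  then obtain z where z: "z \<in> circle" "z \<notin> F ` M" using circ by blast
  define \<alpha> where "\<alpha> = Arg z"
  have "norm z = 1" using z(1) by simp
  then have "z \<noteq> 0" by auto
  then have "z = cis \<alpha>" using cis_Arg[of z] \<open>norm z = 1\<close> by (simp add: \<alpha>_def sgn_div_norm)
  then have "F p \<noteq> cis \<alpha>" if "p \<in> M" for p using that z(2) by (metis imageI)
  then have dom: "F p \<in> chart_dom (angle_chart \<alpha>)" if "p \<in> M" for p
    using that circ by (auto simp: chart_dom_angle_chart)
  have dom': "F p \<in> cis ` {\<alpha><..<\<alpha> + 2 * pi}" if "p \<in> M" for p
    using dom[OF that] by (simp add: angle_chart_def)
  define \<theta> where "\<theta> = (\<lambda>p. inv_into {\<alpha><..<\<alpha> + 2 * pi} cis (F p))"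
  \<comment> \<open>The logarithm formula applies on all of M because F avoids the omitted point; it
    gives continuity of the global angle.\<close>
  have "continuous_on M (\<lambda>p. \<alpha> + pi + Im (Ln (- cis (- \<alpha>) * F p)))"
    using smooth_function_imp_continuous_on[OF smF] rotated_not_nonpos_Real[OF dom']
    by (intro continuous_intros) auto
  then have "continuous_on M \<theta>"
    by (rule continuous_on_eq) (simp add: \<theta>_def inv_into_cis_eq_Ln[OF dom'])
  then obtain p where p: "p \<in> M" "\<And>q. q \<in> M \<Longrightarrow> \<theta> q \<le> \<theta> p"
    using continuous_attains_sup[OF assms(1,2)] by metis
  obtain c where c: "c \<in> A" "p \<in> chart_dom c" using chart_at[OF p(1)] .
  define x where "x = chart_map c p"
  have x: "x \<in> angle_dom \<alpha> c" "chart_inv c x = p"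
    unfolding x_def using point_in_angle_dom[OF c dom[OF p(1)]] chart_inv_chart_map[OF c] by auto
  have "pderiv_at j (angle_rep \<alpha> c F) x = 0" for j
  proof (rule interior_max_imp_pderiv_eq_0[OF open_angle_dom[OF c(1)] x(1)])
    show "angle_rep \<alpha> c F differentiable at x"
      by (rule smooth_on_imp_differentiable[OF smooth_on_angle_rep[OF c(1)] x(1)])
    fix y assume "y \<in> angle_dom \<alpha> c"
    then have "chart_inv c y \<in> M"
      using chart_inv_in_dom[OF c(1)] chart_dom_subset[OF c(1)] unfolding angle_dom_def by blast
    then show "angle_rep \<alpha> c F y \<le> angle_rep \<alpha> c F x"
      using p(2) x(2) by (simp add: angle_rep_def \<theta>_def)
  qed
  then have "energy \<alpha> c x = 0" by (simp add: energy_def gradient_product_def)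
  then show False using energy[OF c dom[OF p(1)]] by (simp add: x_def)
qed

text \<open>Surjectivity stays a clause of its own: it is global, while all other conditions are
  tested at one point in one angle chart.\<close>

lemma harmonic_riemannian_submersion_circle_iff:
  assumes "k > 0"
  shows "harmonic_riemannian_submersion M A g circle circle_atlas (circle_metric (1 / k)) F
    \<longleftrightarrow> F ` M = circle \<and> (\<forall>c\<in>A. \<forall>\<alpha>. \<forall>p\<in>chart_dom c. F p \<in> chart_dom (angle_chart \<alpha>) \<longrightarrow>
      tension_field g (circle_metric (1 / k)) c (angle_chart \<alpha>) F (chart_map c p) = 0 \<and>
      energy \<alpha> c (chart_map c p) = k)"
proof -
  let ?S = "\<lambda>c \<alpha> p. let G = g c (chart_map c p);
            K = circle_metric (1 / k) (angle_chart \<alpha>) (chart_map (angle_chart \<alpha>) (F p));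
            D = frechet_derivative (local_rep c (angle_chart \<alpha>) F) (at (chart_map c p));
            H = {v. \<forall>u. D u = 0 \<longrightarrow> v \<bullet> (G *v u) = 0}
        in surj D \<and> (\<forall>v\<in>H. \<forall>w\<in>H. D v \<bullet> (K *v D w) = v \<bullet> (G *v w))"
  let ?E = "\<lambda>c \<alpha> p. energy \<alpha> c (chart_map c p) = k"
  have eq: "?S c \<alpha> p = ?E c \<alpha> p" if "c \<in> A" "p \<in> chart_dom c \<inter> F -` chart_dom (angle_chart \<alpha>)" for c \<alpha> p
    by (rule riemannian_submersion_at_iff) (use that assms in auto)
  have sub: "riemannian_submersion M A g circle circle_atlas (circle_metric (1 / k)) F
      \<longleftrightarrow> F ` M = circle \<and> (\<forall>c\<in>A. \<forall>\<alpha>. \<forall>p\<in>chart_dom c \<inter> F -` chart_dom (angle_chart \<alpha>). ?S c \<alpha> p)"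
    by (simp only: riemannian_submersion_def smooth_map_circle) (simp only: circle_atlas_def ball_simps ball_UNIV simp_thms)
  have "(\<forall>c\<in>A. \<forall>\<alpha>. \<forall>p\<in>chart_dom c \<inter> F -` chart_dom (angle_chart \<alpha>). ?S c \<alpha> p)
      \<longleftrightarrow> (\<forall>c\<in>A. \<forall>\<alpha>. \<forall>p\<in>chart_dom c \<inter> F -` chart_dom (angle_chart \<alpha>). ?E c \<alpha> p)"
    by (rule ball_cong[OF refl], rule arg_cong[where f = All], rule ext, rule ball_cong[OF refl])
      (rule eq; assumption)
  note sub = sub[unfolded this]
  have harm: "harmonic_map M A g circle circle_atlas (circle_metric (1 / k)) F
      \<longleftrightarrow> (\<forall>c\<in>A. \<forall>\<alpha>. \<forall>p\<in>chart_dom c \<inter> F -` chart_dom (angle_chart \<alpha>).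
        tension_field g (circle_metric (1 / k)) c (angle_chart \<alpha>) F (chart_map c p) = 0)"
    by (simp only: harmonic_map_def smooth_map_circle) (simp only: circle_atlas_def ball_simps ball_UNIV simp_thms)
  show ?thesis
    unfolding harmonic_riemannian_submersion_def sub harm by fast
qed

end

end

section \<open>The equivalence for functions of constant modulus\<close>

context riemannian_manifold
begin

text \<open>Both implications of the theorem reduce to this once |phi| is known to be constant.
  Angle charts are introduced or discarded pointwise, as each value of F lies in one of
  them.\<close>

lemma eigenfunction_iff_harmonic_riemannian_submersion:
  fixes \<phi> :: "'a \<Rightarrow> complex"
  assumes "compact M" "M \<noteq> {}" "smooth_function A \<phi>" "lam < 0" "\<rho> > 0"
    and norm: "\<And>p. p \<in> M \<Longrightarrow> norm (\<phi> p) = \<rho>"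
  shows "eigenfunction A g (complex_of_real lam) (complex_of_real lam) \<phi> \<longleftrightarrow>
    harmonic_riemannian_submersion M A g circle circle_atlas (circle_metric (1 / \<bar>lam\<bar>))
      (\<lambda>x. \<phi> x / complex_of_real \<rho>)"
proof -
  define F where "F = (\<lambda>x. \<phi> x / complex_of_real \<rho>)"
  have \<phi>: "\<phi> = (\<lambda>x. of_real \<rho> * F x)" using assms(5) by (simp add: F_def)
  have circ: "F ` M \<subseteq> circle" using norm assms(5) by (auto simp: F_def norm_divide)
  have smF: "smooth_function A F"
    unfolding smooth_function_def
  proof
    fix c assume c: "c \<in> A"
    have "smooth_on (chart_img c) (\<phi> \<circ> chart_inv c)"
      using assms(3) c unfolding smooth_function_def by (rule bspec)
    from smooth_on_bounded_linear_compose[OF img_open[OF c] bounded_linear_divide this, of "of_real \<rho>"]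
    show "smooth_on (chart_img c) (F \<circ> chart_inv c)" by (simp add: F_def o_def)
  qed
  let ?h = "circle_metric (1 / \<bar>lam\<bar>)"
  let ?e = "\<lambda>c p. laplace_beltrami g c \<phi> (chart_map c p) = complex_of_real lam * \<phi> p \<and>
        conformality g c \<phi> \<phi> (chart_map c p) = complex_of_real lam * (\<phi> p)\<^sup>2"
  let ?s = "\<lambda>c \<alpha> p. tension_field g ?h c (angle_chart \<alpha>) F (chart_map c p) = 0 \<and>
        energy F \<alpha> c (chart_map c p) = \<bar>lam\<bar>"
  have es: "?e c p \<longleftrightarrow> ?s c \<alpha> p"
    if "c \<in> A" "p \<in> chart_dom c" "F p \<in> chart_dom (angle_chart \<alpha>)" for c \<alpha> p
  proof -
    have "complex_of_real \<rho> \<noteq> 0" using assms(5) by simp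
    from eigen_equations_iff[OF smF circ that this] show ?thesis
      unfolding \<phi> using assms(4) by (simp only: abs_of_neg)
  qed
  have "(\<forall>c\<in>A. \<forall>p\<in>chart_dom c. ?e c p) \<longleftrightarrow>
      (\<forall>c\<in>A. \<forall>\<alpha>. \<forall>p\<in>chart_dom c. F p \<in> chart_dom (angle_chart \<alpha>) \<longrightarrow> ?s c \<alpha> p)"
  proof (intro iffI ballI allI impI)
    fix c \<alpha> p assume "\<forall>c\<in>A. \<forall>p\<in>chart_dom c. ?e c p" "c \<in> A" "p \<in> chart_dom c"
      "F p \<in> chart_dom (angle_chart \<alpha>)"
    then show "?s c \<alpha> p" by (subst es[symmetric]) auto
  next
    fix c p assume *: "\<forall>c\<in>A. \<forall>\<alpha>. \<forall>p\<in>chart_dom c. F p \<in> chart_dom (angle_chart \<alpha>) \<longrightarrow> ?s c \<alpha> p"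
      and cp: "c \<in> A" "p \<in> chart_dom c"
    have "F p \<in> circle" using circ cp chart_dom_subset by blast
    then obtain \<alpha> where \<alpha>: "F p \<in> chart_dom (angle_chart \<alpha>)" by (rule angle_chart_at)
    then have "?s c \<alpha> p" using * cp by simp
    then show "?e c p" unfolding es[OF cp \<alpha>] .
  qed
  then have eig: "eigenfunction A g (complex_of_real lam) (complex_of_real lam) \<phi> \<longleftrightarrow>
      (\<forall>c\<in>A. \<forall>\<alpha>. \<forall>p\<in>chart_dom c. F p \<in> chart_dom (angle_chart \<alpha>) \<longrightarrow> ?s c \<alpha> p)"
    unfolding eigenfunction_def using assms(3) by simp
  have k: "\<bar>lam\<bar> > 0" using assms(4) by simp
  \<comment> \<open>The local equations prescribe the energy |lam| > 0, so the angle has no critical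
    point and surjectivity follows from them.\<close>
  have "F ` M = circle"
    if "\<forall>c\<in>A. \<forall>\<alpha>. \<forall>p\<in>chart_dom c. F p \<in> chart_dom (angle_chart \<alpha>) \<longrightarrow> ?s c \<alpha> p"
  proof (rule surj_circle_if_energy_nonzero[OF smF circ assms(1,2)])
    fix c \<alpha> p assume "c \<in> A" "p \<in> chart_dom c" "F p \<in> chart_dom (angle_chart \<alpha>)"
    with that have "energy F \<alpha> c (chart_map c p) = \<bar>lam\<bar>" by blast
    then show "energy F \<alpha> c (chart_map c p) \<noteq> 0" using k by linarith
  qed
  then show ?thesis
    unfolding eig F_def[symmetric] harmonic_riemannian_submersion_circle_iff[OF smF circ k] by blast
qed

end

theorem theorem1p1:
  fixes M :: "'a::{t2_space, second_countable_topology} set"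
    and A :: "('a, 'n::finite) chart set"
    and g :: "('a, 'n) metric"
    and \<phi> :: "'a \<Rightarrow> complex"
    and lam :: real
  assumes "riemannian_manifold M A g"
    and "compact M"
    and "connected M"
    and "smooth_function A \<phi>"
    and "\<not> \<phi> constant_on M"
    and "lam < 0"
  shows "eigenfunction A g (complex_of_real lam) (complex_of_real lam) \<phi> \<longleftrightarrow>
    (\<forall>x\<^sub>0\<in>M. \<phi> x\<^sub>0 \<noteq> 0 \<and>
       (\<lambda>x. \<phi> x / complex_of_real (norm (\<phi> x\<^sub>0))) ` M \<subseteq> circle \<and>
       harmonic_riemannian_submersion M A g circle circle_atlas (circle_metric (1 / \<bar>lam\<bar>))
         (\<lambda>x. \<phi> x / complex_of_real (norm (\<phi> x\<^sub>0))))"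
    (is "?eig \<longleftrightarrow> ?sub")
proof -
  interpret riemannian_manifold M A g by fact
  \<comment> \<open>Every function is constant on the empty set.\<close>
  have ne: "M \<noteq> {}" using assms(5) by (auto simp: constant_on_def)
  note main = eigenfunction_iff_harmonic_riemannian_submersion[OF assms(2) ne assms(4,6)]
  show ?thesis
  proof
    assume eig: ?eig
    obtain r where r: "\<And>p. p \<in> M \<Longrightarrow> (Re (\<phi> p))\<^sup>2 + (Im (\<phi> p))\<^sup>2 = r"
      using eigenfunction_norm_constant[OF assms(2,3) eig] unfolding constant_on_def by blast
    define \<rho> where "\<rho> = sqrt r"
    have norm: "norm (\<phi> p) = \<rho>" if "p \<in> M" for p
      using r[OF that] by (simp add: \<rho>_def cmod_def)
    \<comment> \<open>Modulus 0 would make phi the constant 0.\<close>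
    have "\<rho> > 0"
    proof (rule ccontr)
      assume "\<not> \<rho> > 0"
      then have "\<phi> p = 0" if "p \<in> M" for p using norm[OF that] norm_ge_zero[of "\<phi> p"] by simp
      then show False using assms(5) unfolding constant_on_def by blast
    qed
    note sub = main[OF this norm, THEN iffD1, OF _ eig]
    show ?sub
    proof
      fix x\<^sub>0 assume x0: "x\<^sub>0 \<in> M"
      have "\<phi> x\<^sub>0 \<noteq> 0" using norm[OF x0] \<open>\<rho> > 0\<close> by auto
      moreover have "(\<lambda>x. \<phi> x / complex_of_real \<rho>) ` M \<subseteq> circle"
        using norm \<open>\<rho> > 0\<close> by (auto simp: norm_divide)
      ultimately show "\<phi> x\<^sub>0 \<noteq> 0 \<and> (\<lambda>x. \<phi> x / complex_of_real (norm (\<phi> x\<^sub>0))) ` M \<subseteq> circle \<and>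
          harmonic_riemannian_submersion M A g circle circle_atlas (circle_metric (1 / \<bar>lam\<bar>))
            (\<lambda>x. \<phi> x / complex_of_real (norm (\<phi> x\<^sub>0)))"
        unfolding norm[OF x0] using sub by blast
    qed
  next
    assume sub: ?sub
    obtain x0 where x0: "x0 \<in> M" using ne by blast
    define \<rho> where "\<rho> = norm (\<phi> x0)"
    from sub x0 have s: "\<phi> x0 \<noteq> 0" "(\<lambda>x. \<phi> x / complex_of_real \<rho>) ` M \<subseteq> circle"
      "harmonic_riemannian_submersion M A g circle circle_atlas (circle_metric (1 / \<bar>lam\<bar>))
        (\<lambda>x. \<phi> x / complex_of_real \<rho>)"
      unfolding \<rho>_def by blast+
    have "\<rho> > 0" using s(1) by (simp add: \<rho>_def)
    \<comment> \<open>A single base point suffices: values in the circle fix |phi|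
      everywhere.\<close>
    moreover have "norm (\<phi> p) = \<rho>" if "p \<in> M" for p
    proof -
      have "\<phi> p / complex_of_real \<rho> \<in> circle" using s(2) that by blast
      then show ?thesis using \<open>\<rho> > 0\<close> by (simp add: norm_divide)
    qed
    ultimately show ?eig using main s(3) by blast
  qed
qed

end
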